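(* Let $k\in\mathbb{R}$ and consider two homogeneous layers, i.e. $V(x,\omega)=V_\pm(\omega)$ for $\pm x>0$. Then $$\sigma_p(L_k)\setminus\Omega_0=N^{(k)},$$ where $$N^{(k)}=\Big\{\omega\in\Omega\setminus\Omega_0:\ W_+(\omega),W_-(\omega)\notin[k^2,\infty)\ \text{ and }\ \sqrt{k^2-W_+(\omega)}\,V_-(\omega)+\sqrt{k^2-W_-(\omega)}\,V_+(\omega)=0\Big\}.$$ All eigenvalues in $\sigma_p(L_k)\setminus\Omega_0$ are geometrically simple. An eigenvalue $\omega\in\sigma_p(L_k)\setminus\Omega_0$ is algebraically simple if and only if $$(2k^2-W_+(\omega))(2k^2-W_-(\omega))-2k^4-(k^2-W_+(\omega))V_-(\omega)^2\neq0.$$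
   Context: $V_+,V_-:\Omega\to\mathbb{C}$ are given functions on a set $\Omega\subset\mathbb{C}$ (independent of $x$); $V(x,\omega)=V_+(\omega)$ for $x>0$, $V(x,\omega)=V_-(\omega)$ for $x<0$; $W_\pm(\omega)=-\omega V_\pm(\omega)$; $\Omega_0=\{\omega\in\Omega:\omega=0\text{ or }V_+(\omega)=0\text{ or }V_-(\omega)=0\}$. Square roots are principal (positive real part off $(-\infty,0]$). $A=\begin{pmatrix}0&0&\mathrm{i}k\\0&0&-\partial_x\\-\mathrm{i}k&\partial_x&0\end{pmatrix}$ with domain $D(A)=\{u\in L^2(\mathbb{R},\mathbb{C}^3):u_2,u_3\in H^1(\mathbb{R},\mathbb{C})\}$, $B(x,\omega)=\mathrm{diag}(\mathrm{i}V(x,\omega),\mathrm{i}V(x,\omega),\mathrm{i}\omega)$, $L_k(\omega)=A-B(\cdot,\omega):D(A)\to L^2(\mathbb{R},\mathbb{C}^3)$, $\omega\in\Omega$. $L_k$ denotes the pencil $\omega\mapsto L_k(\omega)$. $\sigma_p(L_k)=\{\omega\in\Omega:\exists u\in D(A)\setminus\{0\},\ L_k(\omega)u=0\}$. $\omega\in\sigma_p(L_k)$ is geometrically simple if $\dim\ker L_k(\omega)=1$; algebraically simple if it is geometrically simple and there is no $u\in D(A)$ with $L_k(\omega)u=v$, where $v\in\ker L_k(\omega)\setminus\{0\}$ and $u,v$ are linearly independent. *)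

theory Defs
  imports "HOL-Analysis.Analysis"
begin

definition square_integrable :: "(real \<Rightarrow> 'a::euclidean_space) \<Rightarrow> bool" where
  "square_integrable f \<longleftrightarrow>
     f \<in> borel_measurable lebesgue \<and> integrable lebesgue (\<lambda>x. (norm (f x))\<^sup>2)"

lemma square_integrable_zero: "square_integrable (\<lambda>x. 0)"
  by (simp add: square_integrable_def)

lemma square_integrable_bound:
  fixes f :: "real \<Rightarrow> 'a::euclidean_space" and g :: "real \<Rightarrow> 'b::euclidean_space"
  assumes f: "square_integrable f" and g: "g \<in> borel_measurable lebesgue"
    and le: "\<And>x. norm (g x) \<le> c * norm (f x)"
  shows "square_integrable g"
  unfolding square_integrable_def
proof
  have int: "integrable lebesgue (\<lambda>x. c\<^sup>2 * (norm (f x))\<^sup>2)"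
    using f by (auto simp: square_integrable_def)
  show "integrable lebesgue (\<lambda>x. (norm (g x))\<^sup>2)"
  proof (rule Bochner_Integration.integrable_bound[OF int])
    show "(\<lambda>x. (norm (g x))\<^sup>2) \<in> borel_measurable lebesgue"
      using g by measurable
    have "(norm (g x))\<^sup>2 \<le> c\<^sup>2 * (norm (f x))\<^sup>2" for x
      using power_mono[OF le[of x], of 2] by (simp add: power_mult_distrib)
    then show "AE x in lebesgue. norm ((norm (g x))\<^sup>2) \<le> norm (c\<^sup>2 * (norm (f x))\<^sup>2)"
      by simp
  qed
qed (rule g)

lemma square_integrable_add:
  fixes f g :: "real \<Rightarrow> 'a::euclidean_space"
  assumes f: "square_integrable f" and g: "square_integrable g"
  shows "square_integrable (\<lambda>x. f x + g x)"
  unfolding square_integrable_def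
proof
  have fm: "f \<in> borel_measurable lebesgue" and gm: "g \<in> borel_measurable lebesgue"
    using f g by (auto simp: square_integrable_def)
  show m: "(\<lambda>x. f x + g x) \<in> borel_measurable lebesgue"
    using fm gm by measurable
  have int: "integrable lebesgue (\<lambda>x. 2 * (norm (f x))\<^sup>2 + 2 * (norm (g x))\<^sup>2)"
    using f g by (auto simp: square_integrable_def)
  show "integrable lebesgue (\<lambda>x. (norm (f x + g x))\<^sup>2)"
  proof (rule Bochner_Integration.integrable_bound[OF int])
    show "(\<lambda>x. (norm (f x + g x))\<^sup>2) \<in> borel_measurable lebesgue"
      using m by measurable
    have "(norm (f x + g x))\<^sup>2 \<le> 2 * (norm (f x))\<^sup>2 + 2 * (norm (g x))\<^sup>2" for x
    proof -
      have "(norm (f x + g x))\<^sup>2 \<le> (norm (f x) + norm (g x))\<^sup>2"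
        by (rule power_mono[OF norm_triangle_ineq]) simp
      also have "\<dots> \<le> 2 * (norm (f x))\<^sup>2 + 2 * (norm (g x))\<^sup>2"
        using sum_squares_bound[of "norm (f x)" "norm (g x)"]
        by (simp add: power2_sum)
      finally show ?thesis .
    qed
    then show "AE x in lebesgue. norm ((norm (f x + g x))\<^sup>2)
        \<le> norm (2 * (norm (f x))\<^sup>2 + 2 * (norm (g x))\<^sup>2)"
      by simp
  qed
qed

lemma norm_vector_scalar_mult: "norm (c *s v) = norm c * norm v"
  for c :: complex and v :: "complex ^ 'n"
proof -
  have "norm (c *s v) = L2_set (\<lambda>i. norm c * norm (v $ i)) UNIV"
    by (simp add: norm_vec_def norm_mult)
  also have "\<dots> = norm c * norm v"
    by (simp add: norm_vec_def L2_set_right_distrib)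
  finally show ?thesis .
qed

lemma bounded_linear_vector_scalar_mult:
  "bounded_linear (\<lambda>v :: complex ^ 'n. c *s v)"
  by (rule bounded_linear_intro[where K = "norm c"])
    (auto simp: norm_vector_scalar_mult vec_eq_iff algebra_simps)

lemma square_integrable_scale:
  fixes f :: "real \<Rightarrow> complex ^ 'n"
  assumes f: "square_integrable f"
  shows "square_integrable (\<lambda>x. c *s f x)"
proof (rule square_integrable_bound[OF f, where c = "norm c"])
  show "(\<lambda>x. c *s f x) \<in> borel_measurable lebesgue"
    using f bounded_linear_vector_scalar_mult[of c]
    by (auto simp: square_integrable_def
      intro: borel_measurable_continuous_on[OF linear_continuous_on])
qed (simp add: norm_vector_scalar_mult)

definition L2_eq :: "(real \<Rightarrow> complex ^ 3) \<Rightarrow> (real \<Rightarrow> complex ^ 3) \<Rightarrow> bool" where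
  "L2_eq f g \<longleftrightarrow>
     square_integrable f \<and> square_integrable g \<and> (AE x in lebesgue. f x = g x)"

quotient_type L2 = "real \<Rightarrow> complex ^ 3" / partial: L2_eq
  morphisms rep_L2 abs_L2
proof (rule part_equivpI)
  show "\<exists>f. L2_eq f f"
    by (rule exI[of _ "\<lambda>x. 0"]) (simp add: L2_eq_def square_integrable_zero)
  show "symp L2_eq"
    by (rule sympI) (auto simp: L2_eq_def)
  show "transp L2_eq"
    by (rule transpI) (auto simp: L2_eq_def)
qed

instantiation L2 :: ab_group_add
begin

lift_definition zero_L2 :: L2 is "\<lambda>x. 0"
  by (simp add: L2_eq_def square_integrable_zero)

lift_definition plus_L2 :: "L2 \<Rightarrow> L2 \<Rightarrow> L2" is "\<lambda>f g x. f x + g x"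
  by (auto simp: L2_eq_def intro!: square_integrable_add)

lift_definition uminus_L2 :: "L2 \<Rightarrow> L2" is "\<lambda>f x. - f x"
  by (auto simp: L2_eq_def square_integrable_def)

definition minus_L2 :: "L2 \<Rightarrow> L2 \<Rightarrow> L2" where
  "minus_L2 u v = u + - v"

instance
proof
  fix a b c :: L2
  show "a + b + c = a + (b + c)"
    by transfer (auto simp: L2_eq_def add.assoc intro!: square_integrable_add)
  show "a + b = b + a"
    by transfer (auto simp: L2_eq_def add.commute intro!: square_integrable_add)
  show "0 + a = a"
    by transfer (auto simp: L2_eq_def)
  show "- a + a = 0"
    by transfer (auto simp: L2_eq_def square_integrable_zero)
  show "a - b = a + - b"
    by (rule minus_L2_def)
qed

end

lift_definition scale_L2 :: "complex \<Rightarrow> L2 \<Rightarrow> L2" is "\<lambda>c f x. c *s f x"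
  by (auto simp: L2_eq_def intro!: square_integrable_scale)

global_interpretation L2: vector_space scale_L2
proof
  fix a b :: complex and u v :: L2
  show "scale_L2 a (u + v) = scale_L2 a u + scale_L2 a v"
    by transfer (auto simp: L2_eq_def vector_add_ldistrib
      intro!: square_integrable_add square_integrable_scale)
  show "scale_L2 (a + b) u = scale_L2 a u + scale_L2 b u"
    by transfer (auto simp: L2_eq_def vector_sadd_rdistrib
      intro!: square_integrable_add square_integrable_scale)
  show "scale_L2 a (scale_L2 b u) = scale_L2 (a * b) u"
    by transfer (auto simp: L2_eq_def vector_smult_assoc
      intro!: square_integrable_scale)
  show "scale_L2 1 u = u"
    by transfer (auto simp: L2_eq_def)
qed

text \<open>Test functions are real-valued; by linearity this gives the same weak derivatives as
  complex-valued ones.\<close>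

definition test_function :: "(real \<Rightarrow> real) \<Rightarrow> bool" where
  "test_function \<phi> \<longleftrightarrow>
     (\<forall>n x. (deriv ^^ n) \<phi> differentiable (at x)) \<and> compact (closure {x. \<phi> x \<noteq> 0})"

definition is_weak_deriv :: "(real \<Rightarrow> complex) \<Rightarrow> (real \<Rightarrow> complex) \<Rightarrow> bool" where
  "is_weak_deriv f g \<longleftrightarrow>
     (\<forall>\<phi>. test_function \<phi> \<longrightarrow>
        (LINT x|lebesgue. f x * of_real (deriv \<phi> x)) = - (LINT x|lebesgue. g x * of_real (\<phi> x)))"

definition H1 :: "(real \<Rightarrow> complex) set" where
  "H1 = {f. square_integrable f \<and> (\<exists>g. square_integrable g \<and> is_weak_deriv f g)}"

text \<open>The choice is immaterial: two square integrable weak derivatives of the same function agree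
  almost everywhere.\<close>

definition weak_deriv :: "(real \<Rightarrow> complex) \<Rightarrow> real \<Rightarrow> complex" where
  "weak_deriv f = (SOME g. square_integrable g \<and> is_weak_deriv f g)"

lemma weak_deriv_H1:
  assumes "f \<in> H1"
  shows "square_integrable (weak_deriv f)" "is_weak_deriv f (weak_deriv f)"
proof -
  have "\<exists>g. square_integrable g \<and> is_weak_deriv f g"
    using assms by (simp add: H1_def)
  from someI_ex[OF this]
  show "square_integrable (weak_deriv f)" "is_weak_deriv f (weak_deriv f)"
    by (simp_all add: weak_deriv_def)
qed

definition component :: "L2 \<Rightarrow> 3 \<Rightarrow> real \<Rightarrow> complex" where
  "component u i = (\<lambda>x. rep_L2 u x $ i)"

definition dom_A :: "L2 set" where
  "dom_A = {u. component u 2 \<in> H1 \<and> component u 3 \<in> H1}"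

definition op_A :: "real \<Rightarrow> L2 \<Rightarrow> L2" where
  "op_A k u = abs_L2 (\<lambda>x. vector
     [ \<i> * of_real k * component u 3 x,
       - weak_deriv (component u 3) x,
       - \<i> * of_real k * component u 1 x + weak_deriv (component u 2) x ])"

text \<open>The value at \<open>x = 0\<close>, a null set, is irrelevant.\<close>

definition two_layer :: "(complex \<Rightarrow> complex) \<Rightarrow> (complex \<Rightarrow> complex) \<Rightarrow> real \<Rightarrow> complex \<Rightarrow> complex" where
  "two_layer Vp Vm x \<omega> = (if x > 0 then Vp \<omega> else Vm \<omega>)"

definition op_B :: "(real \<Rightarrow> complex \<Rightarrow> complex) \<Rightarrow> complex \<Rightarrow> L2 \<Rightarrow> L2" where
  "op_B V \<omega> u = abs_L2 (\<lambda>x. vector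
     [ \<i> * V x \<omega> * component u 1 x,
       \<i> * V x \<omega> * component u 2 x,
       \<i> * \<omega> * component u 3 x ])"

definition pencil :: "(real \<Rightarrow> complex \<Rightarrow> complex) \<Rightarrow> real \<Rightarrow> complex \<Rightarrow> L2 \<Rightarrow> L2" where
  "pencil V k \<omega> u = op_A k u - op_B V \<omega> u"

text \<open>The functions passed to \<^const>\<open>abs_L2\<close> above are square integrable on \<^const>\<open>dom_A\<close>.\<close>

lemma square_integrable_rep: "square_integrable (rep_L2 u)"
  using Quotient3_rep_reflp[OF Quotient3_L2, of u] by (simp add: L2_eq_def)

lemma square_integrable_component: "square_integrable (component u i)"
proof (rule square_integrable_bound[OF square_integrable_rep[of u], where c = 1])
  show "component u i \<in> borel_measurable lebesgue"
    using square_integrable_rep[of u] unfolding component_def square_integrable_def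
    by (intro borel_measurable_continuous_on[where f = "\<lambda>v. v $ i"])
      (auto intro: continuous_intros)
qed (simp add: component_def Finite_Cartesian_Product.norm_nth_le)

lemma square_integrable_cmult:
  fixes f :: "real \<Rightarrow> complex"
  assumes "square_integrable f"
  shows "square_integrable (\<lambda>x. c * f x)"
  using assms by (intro square_integrable_bound[OF assms, where c = "norm c"])
    (auto simp: square_integrable_def norm_mult)

lemma square_integrable_vector_3:
  fixes f g h :: "real \<Rightarrow> complex"
  assumes "square_integrable f" "square_integrable g" "square_integrable h"
  shows "square_integrable (\<lambda>x. vector [f x, g x, h x] :: complex ^ 3)"
proof -
  have ax: "square_integrable (\<lambda>x. axis i (f x) :: complex ^ 3)"
    if f: "square_integrable f" for i and f :: "real \<Rightarrow> complex"
  proof (rule square_integrable_bound[OF f, where c = 1])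
    have n: "norm (axis i z :: complex ^ 3) = norm z" for z
      using exhaust_3[of i] by (auto simp: norm_vec_def L2_set_def sum_3 axis_def)
    have "bounded_linear (\<lambda>z. axis i z :: complex ^ 3)"
      by (rule bounded_linear_intro[where K = 1])
        (simp_all add: n, simp_all add: vec_eq_iff axis_def)
    then show "(\<lambda>x. axis i (f x) :: complex ^ 3) \<in> borel_measurable lebesgue"
      using f by (auto simp: square_integrable_def
        intro: borel_measurable_continuous_on[OF linear_continuous_on])
    show "norm (axis i (f x) :: complex ^ 3) \<le> 1 * norm (f x)" for x
      by (simp add: n)
  qed
  have "(\<lambda>x. vector [f x, g x, h x] :: complex ^ 3)
      = (\<lambda>x. axis 1 (f x) + axis 2 (g x) + axis 3 (h x))"
    by (rule ext) (simp add: vec_eq_iff forall_3 axis_def)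
  then show ?thesis
    using assms by (simp add: ax square_integrable_add)
qed

lemma op_A_square_integrable:
  assumes "u \<in> dom_A"
  shows "square_integrable (\<lambda>x. vector
     [ \<i> * of_real k * component u 3 x,
       - weak_deriv (component u 3) x,
       - \<i> * of_real k * component u 1 x + weak_deriv (component u 2) x ] :: complex ^ 3)"
proof (intro square_integrable_vector_3 square_integrable_add)
  show "square_integrable (\<lambda>x. - weak_deriv (component u 3) x)"
    using square_integrable_cmult[of "weak_deriv (component u 3)" "-1"] assms
    by (simp add: dom_A_def weak_deriv_H1)
  show "square_integrable (\<lambda>x. - \<i> * of_real k * component u 1 x)"
    by (rule square_integrable_cmult[OF square_integrable_component])
qed (use assms in \<open>auto simp: dom_A_def weak_deriv_H1
  intro!: square_integrable_cmult square_integrable_component\<close>)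

lemma op_B_square_integrable:
  "square_integrable (\<lambda>x. vector
     [ \<i> * two_layer Vp Vm x \<omega> * component u 1 x,
       \<i> * two_layer Vp Vm x \<omega> * component u 2 x,
       \<i> * \<omega> * component u 3 x ] :: complex ^ 3)"
proof -
  have "square_integrable (\<lambda>x. \<i> * two_layer Vp Vm x \<omega> * component u i x)" for i
  proof (rule square_integrable_bound[OF square_integrable_component[of u i]])
    have "component u i \<in> borel_measurable lebesgue"
      using square_integrable_component by (auto simp: square_integrable_def)
    then show "(\<lambda>x. \<i> * two_layer Vp Vm x \<omega> * component u i x) \<in> borel_measurable lebesgue"
      unfolding two_layer_def by (intro borel_measurable_times measurable_If) auto
    show "norm (\<i> * two_layer Vp Vm x \<omega> * component u i x)
        \<le> max (norm (Vp \<omega>)) (norm (Vm \<omega>)) * norm (component u i x)" for x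
      by (auto simp: norm_mult two_layer_def intro!: mult_right_mono)
  qed
  then show ?thesis
    by (intro square_integrable_vector_3 square_integrable_cmult square_integrable_component)
qed

definition ker_pencil :: "(real \<Rightarrow> complex \<Rightarrow> complex) \<Rightarrow> real \<Rightarrow> complex \<Rightarrow> L2 set" where
  "ker_pencil V k \<omega> = {u \<in> dom_A. pencil V k \<omega> u = 0}"

definition point_spectrum ::
  "complex set \<Rightarrow> (real \<Rightarrow> complex \<Rightarrow> complex) \<Rightarrow> real \<Rightarrow> complex set" where
  "point_spectrum \<Omega> V k = {\<omega> \<in> \<Omega>. \<exists>u \<in> dom_A - {0}. pencil V k \<omega> u = 0}"

definition geometrically_simple :: "(real \<Rightarrow> complex \<Rightarrow> complex) \<Rightarrow> real \<Rightarrow> complex \<Rightarrow> bool" where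
  "geometrically_simple V k \<omega> \<longleftrightarrow> L2.dim (ker_pencil V k \<omega>) = 1"

text \<open>Linear independence of the pair \<open>u, v\<close> is that of the set \<open>{u, v}\<close> together with
  \<open>u \<noteq> v\<close>.\<close>

definition algebraically_simple :: "(real \<Rightarrow> complex \<Rightarrow> complex) \<Rightarrow> real \<Rightarrow> complex \<Rightarrow> bool" where
  "algebraically_simple V k \<omega> \<longleftrightarrow>
     geometrically_simple V k \<omega> \<and>
     \<not> (\<exists>u \<in> dom_A. \<exists>v \<in> ker_pencil V k \<omega> - {0}.
           pencil V k \<omega> u = v \<and> u \<noteq> v \<and> L2.independent {u, v})"

definition W_of :: "(complex \<Rightarrow> complex) \<Rightarrow> complex \<Rightarrow> complex" where
  "W_of V \<omega> = - \<omega> * V \<omega>"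

definition Omega0 :: "complex set \<Rightarrow> (complex \<Rightarrow> complex) \<Rightarrow> (complex \<Rightarrow> complex) \<Rightarrow> complex set" where
  "Omega0 \<Omega> Vp Vm = {\<omega> \<in> \<Omega>. \<omega> = 0 \<or> Vp \<omega> = 0 \<or> Vm \<omega> = 0}"

definition dispersion_set ::
  "complex set \<Rightarrow> (complex \<Rightarrow> complex) \<Rightarrow> (complex \<Rightarrow> complex) \<Rightarrow> real \<Rightarrow> complex set" where
  "dispersion_set \<Omega> Vp Vm k = {\<omega> \<in> \<Omega> - Omega0 \<Omega> Vp Vm.
     W_of Vp \<omega> \<notin> complex_of_real ` {k\<^sup>2..} \<and>
     W_of Vm \<omega> \<notin> complex_of_real ` {k\<^sup>2..} \<and>
     csqrt (of_real (k\<^sup>2) - W_of Vp \<omega>) * Vm \<omega> + csqrt (of_real (k\<^sup>2) - W_of Vm \<omega>) * Vp \<omega> = 0}"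

end

theory Submission
  imports Defs
begin

text \<open>A square integrable function with a square integrable weak derivative agrees almost everywhere
  with a primitive of that derivative, so an equation \<open>L u = v\<close> becomes a linear ODE for
  \<open>(u\<^sub>3, u\<^sub>2)\<close> on each half-line, with both functions continuous at \<open>0\<close>.  Let
  \<open>\<mu> = sqrt (k\<^sup>2 - W)\<close>, let \<open>e\<close> be the exponential \<open>exp (- \<mu> \<bar>x\<bar>)\<close>, which satisfies the
  homogeneous ODE together with \<open>u\<^sub>2 = \<kappa> e\<close>, and consider the Wronskian
  \<open>(u\<^sub>2 - \<kappa> u\<^sub>3) e\<close>.  If \<open>v = 0\<close> it is constant, hence \<open>0\<close> by square integrability; so
  \<open>u\<close> is a multiple of the exponential on each side, and continuity at \<open>0\<close> is exactly
  \<open>\<kappa>\<^sub>+ = \<kappa>\<^sub>-\<close>, the dispersion relation.  If \<open>v\<close> is an eigenfunction the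
  Wronskian is an explicit multiple of \<open>exp (- 2 \<mu> \<bar>x\<bar>)\<close>; comparing its values at \<open>0\<close> from both
  sides gives the solvability condition, and a solution linear in \<open>x\<close> times the
  exponential shows that the condition is sufficient.\<close>

section \<open>Smooth bump functions\<close>

text \<open>With J = diag(-1, 1, 1), the operator J \<open>L\<close> is symmetric for the pairing
  \<integral> u w without conjugation. Hence \<open>L u = v\<close> with \<open>v\<close> in the
  kernel forces \<integral> (v2^2 + v3^2 - v1^2) = 0. For v = (k/V, \<kappa>, 1) e the integrand is
  \<open>wronskian_slope\<close> times exp (- 2 \<mu> |x|), and its integral over the line is
  \<open>slope_sum\<close>. The Wronskian finds this number one side at a time, with no adjoint or
  Fredholm theory. The first component is never differentiated: the first equation eliminates it,
  and it may jump at 0. The interface conditions concern the other two only. The polynomial of the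
  theorem appears after the dispersion relation is used: in terms of r = \<mu>+ / V+ = - \<mu>- /
  V-, both \<open>slope_sum\<close> and the polynomial are nonzero multiples of V+ V- + r^2 (V+^2 +
  V-^2). Weak derivatives are known only through test functions, so bump functions and the du
  Bois-Reymond lemma come before any ODE. Representatives of \<open>L2\<close> and weak derivatives
  are arbitrary choices, so every pointwise identity about them holds almost everywhere
  only.\<close>

definition smooth :: "(real \<Rightarrow> real) \<Rightarrow> bool" where
  "smooth f \<longleftrightarrow> (\<forall>n x. (deriv ^^ n) f differentiable (at x))"

lemma smooth_differentiable: "smooth f \<Longrightarrow> f differentiable (at x)"
  unfolding smooth_def by (metis funpow_0)

lemma smooth_deriv: "smooth f \<Longrightarrow> smooth (deriv f)"
  unfolding smooth_def by (metis funpow_Suc_right o_apply)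

lemma smooth_has_derivative: "smooth f \<Longrightarrow> (f has_real_derivative deriv f x) (at x)"
  using smooth_differentiable[of f x] DERIV_deriv_iff_real_differentiable by blast

text \<open>By induction all iterated derivatives stay in \<open>S\<close>. Smoothness then needs
  one differentiation step for a suitable family, and no formula for the n-th derivative.\<close>

lemma smooth_coinduct:
  assumes "f \<in> S" and S: "\<And>g. g \<in> S \<Longrightarrow> \<exists>g' \<in> S. \<forall>x. (g has_real_derivative g' x) (at x)"
  shows "smooth f"
proof -
  have "(deriv ^^ n) f \<in> S" for n
  proof (induction n)
    case (Suc n)
    then obtain g' where "g' \<in> S" "\<forall>x. ((deriv ^^ n) f has_real_derivative g' x) (at x)"
      using S by blast
    moreover from this have "deriv ((deriv ^^ n) f) = g'"
      by (auto intro: DERIV_imp_deriv)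
    ultimately show ?case by simp
  qed (simp add: \<open>f \<in> S\<close>)
  then show ?thesis
    unfolding smooth_def using S real_differentiable_def by blast
qed

text \<open>Products alone are not closed under differentiation, because the Leibniz rule yields a
  sum of two products. This is the closure that \<open>smooth_coinduct\<close> needs.\<close>

inductive_set sums_of_products :: "(real \<Rightarrow> real) set" where
  prod: "smooth f \<Longrightarrow> smooth g \<Longrightarrow> (\<lambda>x. f x * g x) \<in> sums_of_products"
| add: "f \<in> sums_of_products \<Longrightarrow> g \<in> sums_of_products \<Longrightarrow> (\<lambda>x. f x + g x) \<in> sums_of_products"

lemma smooth_sums_of_products: "f \<in> sums_of_products \<Longrightarrow> smooth f"
proof (erule smooth_coinduct)
  fix g assume "g \<in> sums_of_products"
  then show "\<exists>g' \<in> sums_of_products. \<forall>x. (g has_real_derivative g' x) (at x)"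
  proof induction
    case (prod f g)
    have "(\<lambda>x. deriv f x * g x + f x * deriv g x) \<in> sums_of_products"
      by (intro sums_of_products.intros prod smooth_deriv)
    moreover have "((\<lambda>x. f x * g x) has_real_derivative deriv f x * g x + f x * deriv g x) (at x)" for x
      using DERIV_mult[OF prod[THEN smooth_has_derivative], of x] by (simp add: mult.commute)
    ultimately show ?case
      by (intro bexI[of _ "\<lambda>x. deriv f x * g x + f x * deriv g x"]) simp_all
  next
    case (add f g)
    then obtain f' g' where "f' \<in> sums_of_products" "g' \<in> sums_of_products"
      "\<forall>x. (f has_real_derivative f' x) (at x)" "\<forall>x. (g has_real_derivative g' x) (at x)" by blast
    then show ?case
      by (intro bexI[of _ "\<lambda>x. f' x + g' x"]) (auto intro: sums_of_products.intros derivative_intros)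
  qed
qed

lemma smooth_mult: "smooth f \<Longrightarrow> smooth g \<Longrightarrow> smooth (\<lambda>x. f x * g x)"
  by (rule smooth_sums_of_products[OF sums_of_products.prod])

lemma smooth_const: "smooth (\<lambda>x. c)"
  by (rule smooth_coinduct[of _ "range (\<lambda>c x. c)"]) (auto intro!: exI[of _ 0])

lemma smooth_add: "smooth f \<Longrightarrow> smooth g \<Longrightarrow> smooth (\<lambda>x. f x + g x)"
  using smooth_sums_of_products[OF sums_of_products.add[OF sums_of_products.prod[of f "\<lambda>_. 1"]
        sums_of_products.prod[of g "\<lambda>_. 1"]]]
  by (simp add: smooth_const)

text \<open>The scalar \<open>c\<close> in the family absorbs the factor \<open>a\<close> that the
  chain rule produces at each differentiation.\<close>

lemma smooth_affine: "smooth f \<Longrightarrow> smooth (\<lambda>x. f (a * x + b))"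
proof (rule smooth_coinduct[of _ "{\<lambda>x. c * g (a * x + b) | c g. smooth g}"])
  assume "smooth f"
  then show "(\<lambda>x. f (a * x + b)) \<in> {\<lambda>x. c * g (a * x + b) | c g. smooth g}"
    by (auto intro!: exI[of _ 1] exI[of _ f])
next
  fix h assume "h \<in> {\<lambda>x. c * g (a * x + b) | c g. smooth g}"
  then obtain c g where h: "h = (\<lambda>x. c * g (a * x + b))" and g: "smooth g" by blast
  have "(h has_real_derivative (c * a) * deriv g (a * x + b)) (at x)" for x
    unfolding h
    by (auto intro!: derivative_eq_intros DERIV_chain2[OF smooth_has_derivative[OF g]])
  moreover have "(\<lambda>x. (c * a) * deriv g (a * x + b)) \<in> {\<lambda>x. c * g (a * x + b) | c g. smooth g}"
    using smooth_deriv[OF g] by blast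
  ultimately show "\<exists>h' \<in> {\<lambda>x. c * g (a * x + b) | c g. smooth g}. \<forall>x. (h has_real_derivative h' x) (at x)"
    by (intro bexI[of _ "\<lambda>x. (c * a) * deriv g (a * x + b)"]) simp_all
qed

text \<open>The classical function exp (-1/x), extended by 0. The polynomial factor makes the family
  closed under differentiation.\<close>

definition flat :: "real poly \<Rightarrow> real \<Rightarrow> real" where
  "flat p x = (if x > 0 then poly p (inverse x) * exp (- inverse x) else 0)"

lemma poly_exp_tendsto_0: "((\<lambda>y. poly p y * exp (- y)) \<longlongrightarrow> 0) at_top" for p :: "real poly"
proof -
  have "((\<lambda>y. coeff p i * (y ^ i / exp y)) \<longlongrightarrow> coeff p i * 0) at_top" for i
    by (intro tendsto_mult tendsto_const tendsto_power_div_exp_0)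
  then have "((\<lambda>y. \<Sum>i\<le>degree p. coeff p i * (y ^ i / exp y)) \<longlongrightarrow> 0) at_top"
    by (intro tendsto_null_sum) simp
  then show ?thesis
    by (simp add: poly_altdef sum_distrib_right exp_minus divide_inverse mult.assoc)
qed

text \<open>With y = 1/x, differentiating p(y) exp (- y) gives (p - p')(y) exp (- y) times - dy/dx =
  y^2, which is the polynomial \<open>[:0, 0, 1:]\<close>.\<close>

lemma flat_has_derivative:
  "(flat p has_real_derivative flat ([:0, 0, 1:] * (p - pderiv p)) x) (at x)"
proof -
  consider "x > 0" | "x < 0" | "x = 0" by linarith
  then show ?thesis
  proof cases
    case 1
    have "((\<lambda>x. poly p (inverse x) * exp (- inverse x)) has_real_derivative
        flat ([:0, 0, 1:] * (p - pderiv p)) x) (at x)"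
      using 1 by (auto intro!: derivative_eq_intros DERIV_chain2[OF poly_DERIV]
          simp: flat_def power2_eq_square algebra_simps)
    then show ?thesis
      by (rule DERIV_cong_ev[THEN iffD1, rotated 3])
        (use 1 eventually_nhds_in_open[of "{0<..}" x] in \<open>auto simp: flat_def elim: eventually_mono\<close>)
  next
    case 2
    have "((\<lambda>x. 0) has_real_derivative flat ([:0, 0, 1:] * (p - pderiv p)) x) (at x)"
      using 2 by (simp add: flat_def)
    then show ?thesis
      by (rule DERIV_cong_ev[THEN iffD1, rotated 3])
        (use 2 eventually_nhds_in_open[of "{..<0}" x] in \<open>auto simp: flat_def elim: eventually_mono\<close>)
  next
    case 3
    \<comment> \<open>Dividing by the increment multiplies by its inverse, and
      \<open>pCons 0 p\<close> is p times the variable. The difference quotient at 0 is thus again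
      of the form covered by \<open>poly_exp_tendsto_0\<close>.\<close>
    have "((\<lambda>y. poly (pCons 0 p) (inverse y) * exp (- inverse y)) \<longlongrightarrow> 0) (at_right 0)"
      using poly_exp_tendsto_0[of "pCons 0 p"] filterlim_inverse_at_top_right
      by (rule filterlim_compose)
    then have "((\<lambda>y. (flat p y - flat p 0) / (y - 0)) \<longlongrightarrow> 0) (at_right 0)"
      by (rule Lim_transform_eventually)
        (auto simp: eventually_at_right_field flat_def field_simps intro!: exI[of _ 1])
    moreover have "((\<lambda>y. (flat p y - flat p 0) / (y - 0)) \<longlongrightarrow> 0) (at_left 0)"
      by (rule Lim_transform_eventually[OF tendsto_const])
        (auto simp: eventually_at_left_field flat_def intro!: exI[of _ "-1"])
    ultimately show ?thesis
      using 3 by (simp add: has_field_derivative_iff filterlim_at_split flat_def)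
  qed
qed

lemma smooth_flat: "smooth (flat p)"
  by (rule smooth_coinduct[of _ "range flat"]) (use flat_has_derivative in blast)+

section \<open>Test functions and approximate indicators of intervals\<close>

lemma test_function_iff:
  "test_function \<phi> \<longleftrightarrow> smooth \<phi> \<and> (\<exists>R > 0. \<forall>x. \<bar>x\<bar> \<ge> R \<longrightarrow> \<phi> x = 0)"
proof -
  have "(\<exists>R > 0. \<forall>x. \<bar>x\<bar> \<ge> R \<longrightarrow> \<phi> x = 0)" if c: "compact (closure {x. \<phi> x \<noteq> 0})"
  proof -
    obtain R where R: "\<And>x. x \<in> closure {x. \<phi> x \<noteq> 0} \<Longrightarrow> \<bar>x\<bar> \<le> R"
      using compact_imp_bounded[OF c] by (auto simp: bounded_iff)
    have "\<phi> x = 0" if "\<bar>x\<bar> \<ge> \<bar>R\<bar> + 1" for x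
    proof (rule ccontr)
      assume "\<phi> x \<noteq> 0"
      then have "\<bar>x\<bar> \<le> R" by (intro R subsetD[OF closure_subset]) auto
      with that show False by linarith
    qed
    then show ?thesis by (intro exI[of _ "\<bar>R\<bar> + 1"]) auto
  qed
  moreover have "compact (closure {x. \<phi> x \<noteq> 0})" if "\<forall>x. \<bar>x\<bar> \<ge> R \<longrightarrow> \<phi> x = 0" for R
  proof -
    have "{x. \<phi> x \<noteq> 0} \<subseteq> {-R..R}"
      using that by (smt (verit) atLeastAtMost_iff mem_Collect_eq subsetI)
    then have "bounded {x. \<phi> x \<noteq> 0}" using bounded_closed_interval bounded_subset by blast
    then show ?thesis by (simp add: compact_closure)
  qed
  ultimately show ?thesis unfolding test_function_def smooth_def by blast
qed

lemma test_functionE: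
  assumes "test_function \<phi>"
  obtains R where "smooth \<phi>" "R > 0" "\<And>x. \<bar>x\<bar> \<ge> R \<Longrightarrow> \<phi> x = 0" "\<And>x. \<bar>x\<bar> \<ge> R \<Longrightarrow> deriv \<phi> x = 0"
proof -
  from assms obtain R where R: "smooth \<phi>" "R > 0" "\<And>x. \<bar>x\<bar> \<ge> R \<Longrightarrow> \<phi> x = 0"
    by (auto simp: test_function_iff)
  \<comment> \<open>The larger radius puts \<open>x\<close> into the open set where
    \<open>\<phi>\<close> vanishes identically.\<close>
  have "deriv \<phi> x = 0" if "\<bar>x\<bar> \<ge> R + 1" for x
  proof -
    have "open (- {-R..R})" "x \<in> - {-R..R}" using that by auto
    then have "\<forall>\<^sub>F y in nhds x. y \<in> - {-R..R}"
      by (rule eventually_nhds_in_open)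
    then have "\<forall>\<^sub>F y in nhds x. \<phi> y = 0"
      by eventually_elim (use R(3) in auto)
    then have "deriv \<phi> x = deriv (\<lambda>x. 0) x" by (rule deriv_cong_ev) simp
    then show ?thesis by simp
  qed
  then show ?thesis using R by (intro that[of "R + 1"]) auto
qed

lemma test_function_deriv: "test_function \<phi> \<Longrightarrow> test_function (deriv \<phi>)"
  by (erule test_functionE) (auto simp: test_function_iff intro: smooth_deriv)

lemma test_function_diff_scale:
  assumes "test_function \<phi>" "test_function \<psi>"
  shows "test_function (\<lambda>x. \<phi> x - c * \<psi> x)"
proof -
  from assms obtain R S where *: "smooth \<phi>" "smooth \<psi>" "R > 0" "S > 0"
    "\<And>x. \<bar>x\<bar> \<ge> R \<Longrightarrow> \<phi> x = 0" "\<And>x. \<bar>x\<bar> \<ge> S \<Longrightarrow> \<psi> x = 0"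
    by (metis test_functionE)
  have "smooth (\<lambda>x. \<phi> x + (- c) * \<psi> x)"
    by (intro smooth_add smooth_mult smooth_const *)
  then show ?thesis
    unfolding test_function_iff using * by (auto intro!: exI[of _ "max R S"])
qed

text \<open>Up to rewriting, the arguments are n (x - a) and n (b - x). Each factor exp (- 1/(n t))
  tends to 1 for t > 0, so these are test functions between 0 and the indicator of [a, b] that
  converge to it off the endpoints. The arguments are spelled out in the form that
  \<open>smooth_affine\<close> expects.\<close>

definition bump :: "real \<Rightarrow> real \<Rightarrow> nat \<Rightarrow> real \<Rightarrow> real" where
  "bump a b n x = flat 1 (real n * x + (- (real n * a))) * flat 1 (- real n * x + real n * b)"

lemma test_function_bump: "test_function (bump a b n)"
proof -
  have "bump a b n x = 0" if "\<bar>x\<bar> \<ge> \<bar>a\<bar> + \<bar>b\<bar> + 1" for x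
  proof (rule ccontr)
    assume "bump a b n x \<noteq> 0"
    then have "real n * x + (- (real n * a)) > 0" "- real n * x + real n * b > 0"
      by (auto simp: bump_def flat_def split: if_splits)
    then have "a < x" "x < b" by (auto simp: mult_less_cancel_left)
    with that show False by linarith
  qed
  moreover have "smooth (bump a b n)"
    unfolding bump_def by (intro smooth_mult smooth_affine smooth_flat)
  ultimately show ?thesis
    unfolding test_function_iff by (auto intro!: exI[of _ "\<bar>a\<bar> + \<bar>b\<bar> + 1"])
qed

lemma flat_1_bounds: "0 \<le> flat 1 x" "flat 1 x \<le> 1"
  by (auto simp: flat_def)

lemma bump_le_indicator: "\<bar>bump a b n x\<bar> \<le> indicator {a..b} x"
proof -
  have "bump a b n x = 0" if "x \<notin> {a..b}"
    using that by (auto simp: bump_def flat_def mult_less_cancel_left not_le)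
  moreover have "0 \<le> bump a b n x" "bump a b n x \<le> 1"
    unfolding bump_def by (auto intro: mult_nonneg_nonneg mult_le_one flat_1_bounds)
  ultimately show ?thesis by (auto simp: indicator_def)
qed

lemma flat_1_tendsto: "x > 0 \<Longrightarrow> (\<lambda>n. flat 1 (real n * x)) \<longlonglongrightarrow> 1"
proof -
  assume "x > 0"
  have "filterlim (\<lambda>n. real n * x) at_top sequentially"
    using filterlim_tendsto_pos_mult_at_top[OF tendsto_const[of x] \<open>x > 0\<close> filterlim_real_sequentially]
    by (simp add: mult.commute)
  then have lim: "(\<lambda>n. exp (- inverse (real n * x))) \<longlonglongrightarrow> exp (- 0)"
    by (intro tendsto_intros tendsto_inverse_0_at_top)
  show ?thesis
  proof (rule Lim_transform_eventually)
    show "\<forall>\<^sub>F n in sequentially. exp (- inverse (real n * x)) = flat 1 (real n * x)"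
      using eventually_gt_at_top[of 0] by eventually_elim (use \<open>x > 0\<close> in \<open>simp add: flat_def\<close>)
  qed (use lim in simp)
qed

lemma bump_tendsto:
  assumes "x \<noteq> a" "x \<noteq> b"
  shows "(\<lambda>n. bump a b n x) \<longlonglongrightarrow> indicator {a..b} x"
proof (cases "x \<in> {a..b}")
  case True
  then have "(\<lambda>n. flat 1 (real n * (x - a)) * flat 1 (real n * (b - x))) \<longlonglongrightarrow> 1 * 1"
    using assms by (intro tendsto_mult flat_1_tendsto) auto
  then show ?thesis
    using True by (simp add: bump_def algebra_simps)
next
  case False
  then have "bump a b n x = 0" for n
    using bump_le_indicator[of a b n x] by simp
  with False show ?thesis by simp
qed

section \<open>Locally integrable functions and test functions\<close>

lemma AE_lebesgue_False: "\<not> (AE x::real in lebesgue. False)"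
  by (simp add: ae_filter_eq_bot_iff eventually_False flip: trivial_limit_def)

text \<open>A class that contains both the square integrable functions and the continuous ones, so
  that a function can be compared with a primitive, which need not be square integrable.\<close>

definition locally_integrable :: "(real \<Rightarrow> complex) \<Rightarrow> bool" where
  "locally_integrable f \<longleftrightarrow> (\<forall>a b. f absolutely_integrable_on {a..b})"

lemma locally_integrableD:
  assumes "locally_integrable f"
  shows "f absolutely_integrable_on {a..b}" "f integrable_on {a..b}" "(\<lambda>x. norm (f x)) integrable_on {a..b}"
  using assms unfolding locally_integrable_def by (auto simp: absolutely_integrable_on_def)

lemma locally_integrable_continuous: "continuous_on UNIV f \<Longrightarrow> locally_integrable f"
  unfolding locally_integrable_def
  by (auto intro: absolutely_integrable_continuous_real continuous_on_subset)

lemma locally_integrable_diff: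
  "locally_integrable f \<Longrightarrow> locally_integrable g \<Longrightarrow> locally_integrable (\<lambda>x. f x - g x)"
  unfolding locally_integrable_def by (auto intro: set_integral_diff)

lemma square_integrable_locally_integrable:
  fixes f :: "real \<Rightarrow> complex"
  assumes "square_integrable f"
  shows "locally_integrable f"
  unfolding locally_integrable_def set_integrable_def
proof (intro allI)
  fix a b
  have "integrable lebesgue (\<lambda>x. indicator {a..b} x + (norm (f x))\<^sup>2 :: real)"
    using assms by (intro Bochner_Integration.integrable_add integrable_real_indicator)
      (auto simp: square_integrable_def emeasure_lborel_Icc_eq)
  then show "integrable lebesgue (\<lambda>x. indicator {a..b} x *\<^sub>R f x)"
  proof (rule Bochner_Integration.integrable_bound)
    show "(\<lambda>x. indicator {a..b} x *\<^sub>R f x) \<in> borel_measurable lebesgue"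
      using assms by (intro borel_measurable_scaleR borel_measurable_indicator)
        (auto simp: square_integrable_def)
    have "t \<le> 1 + t\<^sup>2" if "t \<ge> 0" for t :: real
      using sum_squares_bound[of 1 t] that by simp
    then show "AE x in lebesgue. norm (indicator {a..b} x *\<^sub>R f x)
        \<le> norm (indicator {a..b} x + (norm (f x))\<^sup>2)"
      by (auto simp: indicator_def)
  qed
qed

lemma absolutely_integrable_mult_continuous:
  fixes f c :: "real \<Rightarrow> complex"
  assumes "f absolutely_integrable_on {a..b}" "continuous_on {a..b} c"
  shows "(\<lambda>x. f x * c x) absolutely_integrable_on {a..b}"
proof -
  have "(\<lambda>x. c x * f x) absolutely_integrable_on {a..b}"
  proof (rule absolutely_integrable_bounded_measurable_product[OF bilinear_times])
    show "c \<in> borel_measurable (lebesgue_on {a..b})"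
      by (rule continuous_imp_measurable_on_sets_lebesgue[OF assms(2)]) auto
    show "bounded (c ` {a..b})"
      using assms(2) by (intro compact_imp_bounded compact_continuous_image) auto
  qed (use assms in auto)
  then show ?thesis by (simp add: mult.commute)
qed

text \<open>Passes from Lebesgue integrals over the line, in which weak derivatives are stated, to
  gauge integrals over an interval, for which the fundamental theorem is available.\<close>

lemma integral_against_compact_support:
  fixes f :: "real \<Rightarrow> complex" and \<phi> :: "real \<Rightarrow> real"
  assumes f: "locally_integrable f" and \<phi>: "continuous_on UNIV \<phi>"
    and R: "\<And>x. \<bar>x\<bar> \<ge> R \<Longrightarrow> \<phi> x = 0"
  shows "integrable lebesgue (\<lambda>x. f x * of_real (\<phi> x))"
    and "((\<lambda>x. f x * of_real (\<phi> x)) has_integral (LINT x|lebesgue. f x * of_real (\<phi> x))) {-R..R}"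
proof -
  have "(\<lambda>x. f x * of_real (\<phi> x)) absolutely_integrable_on {-R..R}"
    using \<phi> by (intro absolutely_integrable_mult_continuous locally_integrableD f continuous_intros)
      (auto intro: continuous_on_subset)
  moreover have eq: "(\<lambda>x. indicator {-R..R} x *\<^sub>R (f x * of_real (\<phi> x))) = (\<lambda>x. f x * of_real (\<phi> x))"
    by (rule ext) (auto simp: indicator_def R)
  ultimately show "integrable lebesgue (\<lambda>x. f x * of_real (\<phi> x))"
    and "((\<lambda>x. f x * of_real (\<phi> x)) has_integral (LINT x|lebesgue. f x * of_real (\<phi> x))) {-R..R}"
    using has_integral_set_lebesgue[of "{-R..R}" "\<lambda>x. f x * of_real (\<phi> x)"]
    by (auto simp: set_integrable_def set_lebesgue_integral_def)
qed

lemma smooth_continuous: "smooth f \<Longrightarrow> continuous_on A f"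
  by (metis DERIV_isCont continuous_at_imp_continuous_on smooth_has_derivative)

lemma integrable_test_function:
  assumes "locally_integrable f" "test_function \<phi>"
  shows "integrable lebesgue (\<lambda>x. f x * of_real (\<phi> x))"
  using assms(2)
  by (rule test_functionE) (rule integral_against_compact_support(1)[OF assms(1) smooth_continuous])

text \<open>Testing with \<open>bump\<close> and dominated convergence give zero integral over every
  interval. Lebesgue differentiation then recovers the values of \<open>h\<close>.\<close>

lemma fundamental_lemma_variations:
  assumes h: "locally_integrable h"
    and 0: "\<And>\<psi>. test_function \<psi> \<Longrightarrow> (LINT x|lebesgue. h x * of_real (\<psi> x)) = 0"
  shows "AE x in lebesgue. h x = 0"
proof -
  have int0: "integral {a..b} h = 0" for a b
  proof -
    have "(\<lambda>n. LINT x|lebesgue. h x * of_real (bump a b n x))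
        \<longlonglongrightarrow> (LINT x|lebesgue. h x * of_real (indicator {a..b} x))"
    proof (rule integral_dominated_convergence)
      have i: "integrable lebesgue (\<lambda>x. indicator {a..b} x *\<^sub>R h x)"
        using locally_integrableD(1)[OF h, of a b] by (simp add: set_integrable_def)
      then show "integrable lebesgue (\<lambda>x. norm (indicator {a..b} x *\<^sub>R h x))"
        by (rule integrable_norm)
      show "(\<lambda>x. h x * of_real (indicator {a..b} x)) \<in> borel_measurable lebesgue"
        using borel_measurable_integrable[OF i] by (simp add: scaleR_conv_of_real mult.commute)
      show "(\<lambda>x. h x * of_real (bump a b n x)) \<in> borel_measurable lebesgue" for n
        using borel_measurable_integrable[OF integrable_test_function[OF h test_function_bump]] .
      have "AE x in lebesgue. x \<notin> {a, b}"
        by (intro AE_not_in) (simp flip: negligible_iff_null_sets)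
      then show "AE x in lebesgue. (\<lambda>n. h x * of_real (bump a b n x))
          \<longlonglongrightarrow> h x * of_real (indicator {a..b} x)"
        by eventually_elim (intro tendsto_mult tendsto_const tendsto_of_real bump_tendsto; simp)
      show "AE x in lebesgue. norm (h x * of_real (bump a b n x)) \<le> norm (indicator {a..b} x *\<^sub>R h x)" for n
        using bump_le_indicator[of a b n]
        by (intro AE_I2) (simp add: norm_mult mult.commute mult_left_mono)
    qed
    moreover have "(LINT x|lebesgue. h x * of_real (bump a b n x)) = 0" for n
      by (intro 0 test_function_bump)
    ultimately have "(\<lambda>n::nat. 0) \<longlonglongrightarrow> (LINT x|lebesgue. h x * of_real (indicator {a..b} x))"
      by simp
    then have "(LINT x|lebesgue. h x * of_real (indicator {a..b} x)) = 0"
      by (rule LIMSEQ_unique) (rule tendsto_const)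
    then show ?thesis
      using set_lebesgue_integral_eq_integral(2)[OF locally_integrableD(1)[OF h, of a b]]
      by (simp add: set_lebesgue_integral_def scaleR_conv_of_real mult.commute)
  qed
  \<comment> \<open>Lebesgue differentiation: off \<open>N\<close>, the averages of \<open>h\<close>
    over [x, x + t] converge to \<open>h x\<close>. As all these averages are 0, the tolerance
    \<open>norm (h x)\<close> gives a contradiction below.\<close>
  obtain N where N: "negligible N" "\<And>x e. x \<notin> N \<Longrightarrow> 0 < e \<Longrightarrow>
      \<exists>d>0. \<forall>t. 0 < t \<and> t < d \<longrightarrow> norm (integral (cbox x (x + t *\<^sub>R One)) h /\<^sub>R t ^ DIM(real) - h x) < e"
    by (rule integrable_ccontinuous_explicit[of h]) (auto simp: cbox_interval intro: locally_integrableD(2)[OF h])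
  have "h x = 0" if x: "x \<notin> N" for x
  proof (rule ccontr)
    assume "h x \<noteq> 0"
    then obtain d where d: "d > 0"
      "\<And>t. 0 < t \<Longrightarrow> t < d \<Longrightarrow> norm (integral {x..x + t} h /\<^sub>R t - h x) < norm (h x)"
      using N(2)[OF x, of "norm (h x)"] by (auto simp: cbox_interval)
    from d(2)[of "d / 2"] d(1) show False by (simp add: int0)
  qed
  moreover have "AE x in lebesgue. x \<notin> N"
    using N(1) by (intro AE_not_in) (simp add: negligible_iff_null_sets)
  ultimately show ?thesis by (auto elim: eventually_mono)
qed

text \<open>A primitive that starts left of the support equals the total integral on the right of
  it, so zero mean is what makes it compactly supported.\<close>

lemma zero_mean_primitive:
  assumes \<psi>: "test_function \<psi>" and 0: "(LINT x|lebesgue. \<psi> x) = 0"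
  obtains \<phi> where "test_function \<phi>" "deriv \<phi> = \<psi>"
proof -
  from \<psi> obtain R where R: "smooth \<psi>" "R > 0" "\<And>x. \<bar>x\<bar> \<ge> R \<Longrightarrow> \<psi> x = 0"
    by (rule test_functionE) rule
  \<comment> \<open>The base point lies strictly left of -R. Points beyond it are interior to the
    interval of integration, and all others have a neighbourhood on which \<open>\<phi>\<close> is
    0; together they cover the line.\<close>
  define \<phi> where "\<phi> x = integral {-R-1..x} \<psi>" for x
  have cont: "continuous_on A \<psi>" for A by (rule smooth_continuous[OF R(1)])
  have left: "\<phi> x = 0" if "x \<le> -R" for x
    unfolding \<phi>_def
    by (rule integral_unique, rule has_integral_is_0) (use that R in auto)
  have right: "\<phi> x = 0" if "x \<ge> R" for x
  proof -
    have "integrable lebesgue (\<lambda>x. 1 * complex_of_real (\<psi> x))"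
      by (intro integrable_test_function \<psi> locally_integrable_continuous continuous_intros)
    then have "integrable lebesgue \<psi>" by (simp add: complex_of_real_integrable_eq)
    then have "set_integrable lebesgue {-R-1..x} \<psi>"
      unfolding set_integrable_def by (rule integrable_mult_indicator[rotated]) auto
    then have "(\<psi> has_integral (LINT t:{-R-1..x}|lebesgue. \<psi> t)) {-R-1..x}"
      by (rule has_integral_set_lebesgue)
    moreover have eq: "indicator {-R-1..x} t *\<^sub>R \<psi> t = \<psi> t" for t
    proof (cases "\<bar>t\<bar> < R")
      case True
      with that have "t \<in> {-R-1..x}" by auto
      then show ?thesis by simp
    qed (simp add: R)
    ultimately show ?thesis
      using 0 unfolding \<phi>_def set_lebesgue_integral_def eq by (auto dest: integral_unique)
  qed
  have "(\<phi> has_real_derivative \<psi> x) (at x)" for x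
  proof (cases "x > -R-1")
    case True
    have "(\<phi> has_real_derivative \<psi> x) (at x within {-R-1..x+1})"
      unfolding \<phi>_def by (rule integral_has_real_derivative) (use True cont in auto)
    moreover have "x \<in> interior {-R-1..x+1}" using True by simp
    ultimately show ?thesis by (metis at_within_interior)
  next
    case False
    have "\<forall>\<^sub>F y in nhds x. y \<in> {..<-R}"
      by (rule eventually_nhds_in_open) (use False in auto)
    then have "\<forall>\<^sub>F y in nhds x. \<phi> y = 0"
      by eventually_elim (simp add: left)
    moreover have "\<psi> x = 0" by (rule R) (use False in linarith)
    ultimately show ?thesis
      using DERIV_cong_ev[of x x \<phi> "\<lambda>x. 0" 0 0] by simp
  qed
  note deriv = this
  have d: "deriv \<phi> = \<psi>" by (intro ext DERIV_imp_deriv deriv)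
  have "smooth \<phi>"
    by (rule smooth_coinduct[of _ "insert \<phi> (Collect smooth)"])
      (use deriv R(1) in \<open>auto intro: smooth_has_derivative smooth_deriv\<close>)
  then have "test_function \<phi>"
    unfolding test_function_iff using left right R(2)
    by (intro conjI exI[of _ R]) (auto simp: abs_real_def split: if_splits)
  with d show thesis by (rule that[rotated])
qed

section \<open>Primitives and weak derivatives\<close>

text \<open>Continuity of \<open>A\<close> makes the bound o(y - x), so \<open>H\<close> has
  derivative 0 everywhere, with no differentiability of \<open>A\<close>.\<close>

lemma constant_if_increments_dominated:
  fixes H :: "real \<Rightarrow> complex" and A :: "real \<Rightarrow> real"
  assumes A: "continuous_on {a..b} A" and "a \<le> b"
    and le: "\<And>x y. a \<le> x \<Longrightarrow> x \<le> y \<Longrightarrow> y \<le> b \<Longrightarrow> norm (H y - H x) \<le> (y - x) * \<bar>A y - A x\<bar>"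
  shows "H b = H a"
proof -
  have "\<exists>c. \<forall>x \<in> {a..b}. H x = c"
  proof (rule has_derivative_zero_constant)
    fix x assume x: "x \<in> {a..b}"
    show "(H has_derivative (\<lambda>_. 0)) (at x within {a..b})"
      unfolding has_derivative_within_alt
    proof (intro conjI allI impI)
      fix e :: real assume "e > 0"
      then obtain d where d: "d > 0" "\<And>y. y \<in> {a..b} \<Longrightarrow> dist y x < d \<Longrightarrow> dist (A y) (A x) < e"
        using A x unfolding continuous_on_iff by blast
      have "norm (H y - H x - 0) \<le> e * norm (y - x)" if y: "y \<in> {a..b}" "norm (y - x) < d" for y
      proof -
        have "norm (H y - H x) \<le> \<bar>y - x\<bar> * \<bar>A y - A x\<bar>"
          using le[of x y] le[of y x] x y(1) by (cases "x \<le> y") (auto simp: norm_minus_commute abs_minus_commute)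
        also have "\<dots> \<le> \<bar>y - x\<bar> * e"
          using d(2)[OF y(1)] y(2) by (intro mult_left_mono) (auto simp: dist_real_def)
        finally show ?thesis by (simp add: mult.commute)
      qed
      then show "\<exists>d>0. \<forall>y\<in>{a..b}. norm (y - x) < d \<longrightarrow> norm (H y - H x - 0) \<le> e * norm (y - x)"
        using d(1) by blast
    qed simp
  qed simp
  then show ?thesis using \<open>a \<le> b\<close> by auto
qed

lemma continuous_on_primitive:
  assumes g: "locally_integrable g" and G: "\<And>a b. a \<le> b \<Longrightarrow> (g has_integral (G b - G a)) {a..b}"
  shows "continuous_on UNIV G"
  unfolding continuous_on_eq_continuous_at[OF open_UNIV]
proof
  fix x :: real
  have "continuous_on {x - 1..x + 1} (\<lambda>t. G (x - 1) + integral {x - 1..t} g)"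
    by (intro continuous_intros indefinite_integral_continuous_1 locally_integrableD(2)[OF g])
  moreover have "G (x - 1) + integral {x - 1..t} g = G t" if "t \<in> {x - 1..x + 1}" for t
    using G[of "x - 1" t] that by (auto dest: integral_unique)
  ultimately have "continuous_on {x - 1..x + 1} G"
    by (rule continuous_on_eq)
  then show "isCont G x"
    by (rule continuous_on_interior) simp
qed

text \<open>Since \<open>G\<close> need not be differentiable, integration by parts is replaced by an estimate of
  the increments of \<open>G \<phi> - \<integral> (G \<phi>' + g \<phi>)\<close>, which are
  \<open>\<integral> (g (\<phi> y - \<phi>) + (G x - G) \<phi>')\<close>, hence of order \<open>o(y - x)\<close>.\<close>

lemma is_weak_deriv_primitive:
  assumes g: "locally_integrable g" and G: "\<And>a b. a \<le> b \<Longrightarrow> (g has_integral (G b - G a)) {a..b}"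
  shows "is_weak_deriv G g"
  unfolding is_weak_deriv_def
proof (intro allI impI)
  fix \<phi> assume "test_function \<phi>"
  then obtain R where R: "smooth \<phi>" "R > 0" "\<And>x. \<bar>x\<bar> \<ge> R \<Longrightarrow> \<phi> x = 0" "\<And>x. \<bar>x\<bar> \<ge> R \<Longrightarrow> deriv \<phi> x = 0"
    by (rule test_functionE) rule
  have Gc: "continuous_on UNIV G" by (rule continuous_on_primitive[OF g G])
  have \<phi>c: "continuous_on S \<phi>" "continuous_on S (deriv \<phi>)" for S
    by (intro smooth_continuous R(1) smooth_deriv)+
  have "bounded (deriv \<phi> ` {-R..R})"
    by (intro compact_imp_bounded compact_continuous_image \<phi>c) simp
  then obtain C where "\<forall>z \<in> deriv \<phi> ` {-R..R}. norm z \<le> C"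
    unfolding bounded_iff by blast
  then have C: "\<bar>deriv \<phi> x\<bar> \<le> C" if "x \<in> {-R..R}" for x
    using that by auto
  have C0: "C \<ge> 0" using C[of 0] R(2) by auto
  have lip: "\<bar>\<phi> y - \<phi> x\<bar> \<le> C * (y - x)" if "-R \<le> x" "x \<le> y" "y \<le> R" for x y
  proof -
    have "norm (\<phi> y - \<phi> x) \<le> C * norm (y - x)"
    proof (rule field_differentiable_bound[of "{-R..R}" \<phi> "deriv \<phi>"])
      show "(\<phi> has_field_derivative deriv \<phi> z) (at z within {-R..R})" for z
        using smooth_has_derivative[OF R(1)] has_field_derivative_at_within by blast
    qed (use C that in auto)
    with that show ?thesis by simp
  qed
  define K where "K t = G t * of_real (deriv \<phi> t) + g t * of_real (\<phi> t)" for t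
  define I where "I x = integral {-R..x} K" for x
  define H where "H x = G x * of_real (\<phi> x) - I x" for x
  \<comment> \<open>Each of the two terms in the increment of \<open>H\<close> is at most C (y - x)
    times the integral of |g| over [x, y], hence the factor 2.\<close>
  define A where "A x = 2 * C * integral {-R..x} (\<lambda>t. norm (g t))" for x
  have int1: "((\<lambda>t. G t * of_real (deriv \<phi> t)) has_integral
      (LINT t|lebesgue. G t * of_real (deriv \<phi> t))) {-R..R}"
    by (intro integral_against_compact_support(2) locally_integrable_continuous Gc \<phi>c R(4))
  have int2: "((\<lambda>t. g t * of_real (\<phi> t)) has_integral (LINT t|lebesgue. g t * of_real (\<phi> t))) {-R..R}"
    by (intro integral_against_compact_support(2) g \<phi>c R(3))
  have K: "K integrable_on {-R..R}"
    unfolding K_def using has_integral_add[OF int1 int2] by blast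
  have "H R = H (-R)"
  proof (rule constant_if_increments_dominated[of "-R" R A])
    show "continuous_on {-R..R} A"
      unfolding A_def
      by (intro continuous_intros indefinite_integral_continuous_1 locally_integrableD(3)[OF g])
    fix x y assume xy: "-R \<le> x" "x \<le> y" "y \<le> R"
    define a where "a = integral {x..y} (\<lambda>t. norm (g t))"
    have na: "((\<lambda>t. norm (g t)) has_integral a) {x..y}"
      unfolding a_def by (intro integrable_integral locally_integrableD(3)[OF g])
    have "integral {-R..y} (\<lambda>t. norm (g t)) = integral {-R..x} (\<lambda>t. norm (g t)) + a"
      using Henstock_Kurzweil_Integration.integral_combine[of "-R" x y "\<lambda>t. norm (g t)"] xy
        locally_integrableD(3)[OF g] by (simp add: a_def)
    then have A_diff: "A y - A x = 2 * C * a"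
      by (simp add: A_def algebra_simps)
    have I_diff: "(K has_integral (I y - I x)) {x..y}"
    proof -
      have "K integrable_on {-R..y}" "K integrable_on {x..y}"
        by (rule integrable_on_subinterval[OF K]; use xy in auto)+
      then show ?thesis
        using Henstock_Kurzweil_Integration.integral_combine[of "-R" x y K] xy
        by (simp add: I_def has_integral_iff algebra_simps)
    qed
    have ftc: "((\<lambda>t. complex_of_real (deriv \<phi> t)) has_integral (of_real (\<phi> y) - of_real (\<phi> x))) {x..y}"
    proof (rule fundamental_theorem_of_calculus[OF \<open>x \<le> y\<close>])
      fix t
      have "((\<lambda>t. complex_of_real (\<phi> t)) has_vector_derivative of_real (deriv \<phi> t)) (at t)"
        by (rule has_vector_derivative_of_real)
          (use smooth_has_derivative[OF R(1)] has_real_derivative_iff_has_vector_derivative in blast)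
      then show "((\<lambda>t. complex_of_real (\<phi> t)) has_vector_derivative of_real (deriv \<phi> t)) (at t within {x..y})"
        by (rule has_vector_derivative_at_within)
    qed
    \<comment> \<open>With \<open>\<phi>\<close> frozen at \<open>y\<close> and \<open>G\<close>
      frozen at \<open>x\<close>, each term has a known integral, and no product rule for
      \<open>G\<close> is needed.\<close>
    have "((\<lambda>t. g t * of_real (\<phi> y) + G x * of_real (deriv \<phi> t) - K t) has_integral
        (G y - G x) * of_real (\<phi> y) + G x * (of_real (\<phi> y) - of_real (\<phi> x)) - (I y - I x)) {x..y}"
      by (intro has_integral_diff has_integral_add has_integral_mult_left has_integral_mult_right
          G ftc I_diff xy)
    then have hi: "((\<lambda>t. g t * of_real (\<phi> y - \<phi> t) + (G x - G t) * of_real (deriv \<phi> t)) has_integral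
        (H y - H x)) {x..y}"
      by (simp add: H_def K_def algebra_simps)
    have hb: "((\<lambda>t. norm (g t) * (C * (y - x)) + a * C) has_integral a * (C * (y - x)) + a * C * (y - x)) {x..y}"
      using has_integral_add[OF has_integral_mult_left[OF na, of "C * (y - x)"] has_integral_const_real[of "a * C" x y]] xy
      by (simp add: algebra_simps)
    have "norm (integral {x..y} (\<lambda>t. g t * of_real (\<phi> y - \<phi> t) + (G x - G t) * of_real (deriv \<phi> t)))
      \<le> integral {x..y} (\<lambda>t. norm (g t) * (C * (y - x)) + a * C)"
    proof (rule Henstock_Kurzweil_Integration.integral_norm_bound_integral)
      fix t assume t: "t \<in> {x..y}"
      have "norm (G t - G x) \<le> integral {x..t} (\<lambda>t. norm (g t))"
        using Henstock_Kurzweil_Integration.integral_norm_bound_integral[of g "{x..t}" "\<lambda>t. norm (g t)"]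
          G[of x t] t locally_integrableD[OF g] by (auto simp: has_integral_iff)
      also have "\<dots> \<le> a"
        unfolding a_def using t locally_integrableD(3)[OF g] by (intro integral_subset_le) auto
      finally have Gt: "norm (G x - G t) \<le> a" by (simp add: norm_minus_commute)
      have "\<bar>\<phi> y - \<phi> t\<bar> \<le> C * (y - t)" using lip[of t y] t xy by simp
      also have "\<dots> \<le> C * (y - x)" using t C0 by (intro mult_left_mono) auto
      finally have "norm (g t * of_real (\<phi> y - \<phi> t)) \<le> norm (g t) * (C * (y - x))"
        by (simp add: norm_mult mult_left_mono del: of_real_diff)
      moreover have "norm ((G x - G t) * of_real (deriv \<phi> t)) \<le> a * C"
        using Gt C[of t] t xy by (simp add: norm_mult mult_mono')
      ultimately show "norm (g t * of_real (\<phi> y - \<phi> t) + (G x - G t) * of_real (deriv \<phi> t))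
          \<le> norm (g t) * (C * (y - x)) + a * C"
        by (intro order_trans[OF norm_triangle_ineq] add_mono)
    qed (use hi hb in blast)+
    then have "norm (H y - H x) \<le> (y - x) * (A y - A x)"
      unfolding integral_unique[OF hi] integral_unique[OF hb] A_diff by (simp add: algebra_simps)
    also have "\<dots> \<le> (y - x) * \<bar>A y - A x\<bar>"
      using xy by (intro mult_left_mono) auto
    finally show "norm (H y - H x) \<le> (y - x) * \<bar>A y - A x\<bar>" .
  qed (use R(2) in simp)
  then have "integral {-R..R} K = 0"
    using R(2) R(3)[of R] R(3)[of "-R"] by (simp add: H_def I_def)
  moreover have "integral {-R..R} K = (LINT t|lebesgue. G t * of_real (deriv \<phi> t))
      + (LINT t|lebesgue. g t * of_real (\<phi> t))"
    unfolding K_def using has_integral_add[OF int1 int2] by blast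
  ultimately show "(LINT t|lebesgue. G t * of_real (deriv \<phi> t)) = - (LINT t|lebesgue. g t * of_real (\<phi> t))"
    by (simp add: eq_neg_iff_add_eq_0)
qed

text \<open>Subtracting a multiple of a fixed \<open>\<eta>\<close> with nonzero mean turns any test
  function into one of zero mean, that is, into a derivative. The constant is the average of
  \<open>h\<close> weighted by \<open>\<eta>\<close>.\<close>

lemma du_Bois_Reymond:
  assumes h: "locally_integrable h"
    and 0: "\<And>\<phi>. test_function \<phi> \<Longrightarrow> (LINT x|lebesgue. h x * of_real (deriv \<phi> x)) = 0"
  obtains c where "AE x in lebesgue. h x = c"
proof -
  have one: "locally_integrable (\<lambda>_. c)" for c
    by (intro locally_integrable_continuous continuous_intros)
  \<comment> \<open>If all test functions had mean 0, the fundamental lemma would make the constant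
    1 vanish; this avoids evaluating the integral of a bump.\<close>
  obtain \<eta> where \<eta>: "test_function \<eta>" and J: "(LINT x|lebesgue. \<eta> x) \<noteq> 0"
  proof (rule ccontr)
    assume "\<not> thesis"
    then have "(LINT x|lebesgue. \<psi> x) = 0" if "test_function \<psi>" for \<psi>
      using that \<open>\<And>\<eta>. test_function \<eta> \<Longrightarrow> (LINT x|lebesgue. \<eta> x) \<noteq> 0 \<Longrightarrow> thesis\<close> by blast
    then have "AE x::real in lebesgue. (\<lambda>_. 1 :: complex) x = 0"
      by (intro fundamental_lemma_variations one) simp
    then have "AE x::real in lebesgue. False" by simp
    then show False by (simp add: AE_lebesgue_False)
  qed
  define J where "J = (LINT x|lebesgue. \<eta> x)"
  define c where "c = (LINT x|lebesgue. h x * of_real (\<eta> x)) / of_real J"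
  have "AE x in lebesgue. h x - c = 0"
  proof (rule fundamental_lemma_variations)
    show "locally_integrable (\<lambda>x. h x - c)"
      by (intro locally_integrable_diff h one)
    fix \<psi> assume \<psi>: "test_function \<psi>"
    define m where "m = (LINT x|lebesgue. \<psi> x) / J"
    have ir: "integrable lebesgue \<phi>" if "test_function \<phi>" for \<phi>
      using integrable_test_function[OF one[of 1] that] by (simp add: complex_of_real_integrable_eq)
    note ih = integrable_test_function[OF h]
    have "(LINT x|lebesgue. \<psi> x - m * \<eta> x) = 0"
      using J by (simp add: ir \<psi> \<eta> m_def J_def)
    then obtain \<phi> where \<phi>: "test_function \<phi>" "deriv \<phi> = (\<lambda>x. \<psi> x - m * \<eta> x)"
      using zero_mean_primitive test_function_diff_scale[OF \<psi> \<eta>] by blast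
    have "0 = (LINT x|lebesgue. h x * of_real (\<psi> x) - of_real m * (h x * of_real (\<eta> x)))"
      using 0[OF \<phi>(1)] by (simp add: \<phi>(2) algebra_simps)
    also have "\<dots> = (LINT x|lebesgue. h x * of_real (\<psi> x)) - of_real m * (LINT x|lebesgue. h x * of_real (\<eta> x))"
      using ih \<psi> \<eta> by (subst Bochner_Integration.integral_diff) auto
    also have "of_real m * (LINT x|lebesgue. h x * of_real (\<eta> x)) = c * of_real (LINT x|lebesgue. \<psi> x)"
      by (simp add: c_def m_def)
    finally have eq: "(LINT x|lebesgue. h x * of_real (\<psi> x)) = c * of_real (LINT x|lebesgue. \<psi> x)" by simp
    have "(LINT x|lebesgue. (h x - c) * of_real (\<psi> x))
        = (LINT x|lebesgue. h x * of_real (\<psi> x)) - (LINT x|lebesgue. c * of_real (\<psi> x))"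
      using ih[OF \<psi>] ir[OF \<psi>]
      by (simp add: left_diff_distrib complex_of_real_integrable_eq)
    then show "(LINT x|lebesgue. (h x - c) * of_real (\<psi> x)) = 0"
      using eq by simp
  qed
  then show thesis by (intro that[of c]) simp
qed

text \<open>\<open>f\<close> minus a primitive of \<open>g\<close> has weak derivative 0 and is
  constant by du Bois-Reymond. The continuous \<open>F\<close> gives meaning to the value at the
  interface.\<close>

lemma weak_deriv_primitive:
  assumes f: "locally_integrable f" and g: "locally_integrable g" and fg: "is_weak_deriv f g"
  obtains F where "continuous_on UNIV F" "AE x in lebesgue. f x = F x"
    "\<And>a b. a \<le> b \<Longrightarrow> (g has_integral (F b - F a)) {a..b}"
proof -
  \<comment> \<open>Two cases, because the integral over \<open>{0..x}\<close> is 0 rather than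
    signed for x < 0.\<close>
  define G where "G x = (if x \<ge> 0 then integral {0..x} g else - integral {x..0} g)" for x
  have G: "(g has_integral (G b - G a)) {a..b}" if "a \<le> b" for a b
  proof -
    note c = Henstock_Kurzweil_Integration.integral_combine[OF _ _ locally_integrableD(2)[OF g]]
    have "integral {a..b} g = G b - G a"
      using c[of a 0 b] c[of 0 a b] c[of a b 0] that by (auto simp: G_def algebra_simps)
    then show ?thesis using locally_integrableD(2)[OF g] by (simp add: has_integral_iff)
  qed
  have Gc: "continuous_on UNIV G" by (rule continuous_on_primitive[OF g G])
  have Gl: "locally_integrable G" by (rule locally_integrable_continuous[OF Gc])
  have "(LINT x|lebesgue. (f x - G x) * of_real (deriv \<phi> x)) = 0" if "test_function \<phi>" for \<phi>
  proof -
    have i: "integrable lebesgue (\<lambda>x. f x * of_real (deriv \<phi> x))" "integrable lebesgue (\<lambda>x. G x * of_real (deriv \<phi> x))"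
      using integrable_test_function f Gl test_function_deriv[OF that] by auto
    have "(LINT x|lebesgue. (f x - G x) * of_real (deriv \<phi> x))
        = (LINT x|lebesgue. f x * of_real (deriv \<phi> x)) - (LINT x|lebesgue. G x * of_real (deriv \<phi> x))"
      using i by (simp add: left_diff_distrib)
    then show ?thesis
      using fg is_weak_deriv_primitive[OF g G] that by (simp add: is_weak_deriv_def)
  qed
  then obtain c where c: "AE x in lebesgue. f x - G x = c"
    using du_Bois_Reymond[OF locally_integrable_diff[OF f Gl]] by blast
  show thesis
  proof (rule that[of "\<lambda>x. G x + c"])
    show "AE x in lebesgue. f x = G x + c"
      using c by eventually_elim (simp add: algebra_simps)
  qed (use G Gc in \<open>auto intro: continuous_intros\<close>)
qed

text \<open>\<open>weak_deriv\<close> is a choice; this identifies it almost everywhere with a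
  derivative computed by hand.\<close>

lemma is_weak_deriv_unique:
  assumes "locally_integrable g" "locally_integrable g'" "is_weak_deriv f g" "is_weak_deriv f g'"
  shows "AE x in lebesgue. g x = g' x"
proof -
  have "AE x in lebesgue. g x - g' x = 0"
    by (rule fundamental_lemma_variations)
      (use assms in \<open>auto simp: left_diff_distrib is_weak_deriv_def integrable_test_function
         intro: locally_integrable_diff\<close>)
  then show ?thesis by simp
qed

lemma is_weak_deriv_cong_AE:
  assumes "locally_integrable f" "locally_integrable g" "locally_integrable f'" "locally_integrable g'"
    and "AE x in lebesgue. f x = f' x" "AE x in lebesgue. g x = g' x" and "is_weak_deriv f g"
  shows "is_weak_deriv f' g'"
  unfolding is_weak_deriv_def
proof (intro allI impI)
  fix \<phi> assume \<phi>: "test_function \<phi>"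
  note m = borel_measurable_integrable[OF integrable_test_function]
  have "(LINT x|lebesgue. f' x * of_real (deriv \<phi> x)) = (LINT x|lebesgue. f x * of_real (deriv \<phi> x))"
    using assms(5) by (intro integral_cong_AE m assms test_function_deriv \<phi>) auto
  moreover have "(LINT x|lebesgue. g' x * of_real (\<phi> x)) = (LINT x|lebesgue. g x * of_real (\<phi> x))"
    using assms(6) by (intro integral_cong_AE m assms \<phi>) auto
  ultimately show "(LINT x|lebesgue. f' x * of_real (deriv \<phi> x)) = - (LINT x|lebesgue. g' x * of_real (\<phi> x))"
    using assms(7) \<phi> by (simp add: is_weak_deriv_def)
qed

section \<open>The Wronskian on a half-line\<close>

text \<open>An interval of length L inside the ray contributes at least L \<delta>^2 to the
  integral, for every L. The sign \<open>s\<close> lets one statement serve both ends of the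
  line.\<close>

lemma square_integrable_half_line_bound:
  fixes f :: "real \<Rightarrow> complex"
  assumes f: "square_integrable f" and s: "s = 1 \<or> s = -1"
    and le: "\<And>t. t \<ge> T \<Longrightarrow> norm (f (s * t)) \<ge> \<delta>"
  shows "\<delta> \<le> 0"
proof (rule ccontr)
  assume "\<not> \<delta> \<le> 0"
  then have "\<delta> > 0" by simp
  define I where "I = (LINT x|lebesgue. (norm (f x))\<^sup>2)"
  have int: "integrable lebesgue (\<lambda>x. (norm (f x))\<^sup>2)"
    using f by (simp add: square_integrable_def)
  have "L * \<delta>\<^sup>2 \<le> I" if "L \<ge> 0" for L
  proof -
    define J where "J = (if s = 1 then {T..T + L} else {-T-L..-T})"
    have J: "J \<in> sets lebesgue" "emeasure lebesgue J = L"
      using that unfolding J_def by simp_all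
    then have m: "measure lebesgue J = L" using that by (simp add: measure_def)
    have i: "integrable lebesgue (\<lambda>x. indicator J x * \<delta>\<^sup>2)"
      using J by (intro integrable_mult_left integrable_real_indicator) auto
    have "L * \<delta>\<^sup>2 = (LINT x|lebesgue. indicator J x * \<delta>\<^sup>2)"
      using J m by simp
    also have "\<dots> \<le> I"
      unfolding I_def
    proof (rule integral_mono[OF i int])
      fix x
      show "indicator J x * \<delta>\<^sup>2 \<le> (norm (f x))\<^sup>2"
      proof (cases "x \<in> J")
        case True
        then have "T \<le> s * x" "s * (s * x) = x" using s unfolding J_def by (elim disjE; simp)+
        then have "norm (f x) \<ge> \<delta>" using le[of "s * x"] by (simp only:)
        then show ?thesis using \<open>\<delta> > 0\<close> True by (simp add: power_mono)
      qed simp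
    qed
    finally show ?thesis .
  qed
  \<comment> \<open>For this length the inequality reads |I| + 1 \<le> I.\<close>
  from this[of "(\<bar>I\<bar> + 1) / \<delta>\<^sup>2"] \<open>\<delta> > 0\<close> show False by simp
qed

lemma square_integrable_cong_AE:
  fixes f g :: "real \<Rightarrow> complex"
  assumes f: "square_integrable f" and g: "continuous_on UNIV g" and eq: "AE x in lebesgue. f x = g x"
  shows "square_integrable g"
proof -
  have gm: "g \<in> borel_measurable lebesgue"
    using continuous_imp_measurable_on_sets_lebesgue[OF g] by (simp add: lebesgue_on_UNIV_eq)
  have "integrable lebesgue (\<lambda>x. (norm (g x))\<^sup>2)"
  proof (rule integrable_cong_AE_imp)
    show "integrable lebesgue (\<lambda>x. (norm (f x))\<^sup>2)" using f by (simp add: square_integrable_def)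
    show "(\<lambda>x. (norm (g x))\<^sup>2) \<in> borel_measurable lebesgue" using gm by measurable
    show "AE x in lebesgue. (norm (f x))\<^sup>2 = (norm (g x))\<^sup>2" using eq by eventually_elim simp
  qed
  with gm show ?thesis by (simp add: square_integrable_def)
qed

lemma constant_on_half_line:
  fixes f :: "real \<Rightarrow> complex"
  assumes "\<And>t. t \<ge> 0 \<Longrightarrow> (f has_vector_derivative 0) (at t within {0..})" and "t \<ge> 0"
  shows "f t = f 0"
proof -
  have "\<exists>c. \<forall>t \<in> {0..}. f t = c"
    by (rule has_derivative_zero_constant) (use assms in \<open>auto simp: has_vector_derivative_def\<close>)
  then show ?thesis using \<open>t \<ge> 0\<close> by auto
qed

lemma exp_has_vector_derivative:
  "((\<lambda>t. exp (m * complex_of_real t)) has_vector_derivative m * exp (m * of_real t)) (at t within S)"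
proof -
  have "((\<lambda>z. exp (m * z)) has_field_derivative m * exp (m * of_real t)) (at (complex_of_real t))"
    by (auto intro!: derivative_eq_intros)
  then show ?thesis
    by (rule has_vector_derivative_real_field)
qed

lemma norm_exp_le_1: "Re m \<ge> 0 \<Longrightarrow> t \<ge> 0 \<Longrightarrow> norm (exp (- m * complex_of_real t)) \<le> 1"
  by simp

lemma exp_decay: "Re m > 0 \<Longrightarrow> ((\<lambda>t. exp (- m * complex_of_real t)) \<longlongrightarrow> 0) at_top"
proof -
  assume "Re m > 0"
  then have "filterlim (\<lambda>t. - Re m * t) at_bot at_top"
    by (intro filterlim_tendsto_neg_mult_at_bot[OF tendsto_const] filterlim_ident) auto
  then have "((\<lambda>t. exp (- Re m * t)) \<longlongrightarrow> 0) at_top"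
    by (rule filterlim_compose[OF exp_at_bot])
  then have "((\<lambda>t. norm (exp (- m * complex_of_real t))) \<longlongrightarrow> 0) at_top" by simp
  then show ?thesis by (rule tendsto_norm_zero_cancel)
qed

text \<open>The homogeneous system multiplies q - \<kappa> p by \<mu>, which the factor e undoes, so
  only the source terms survive. Here \<open>v\<close> is 1/V and \<open>i\<close> the imaginary
  unit: with their relations as premises the claim is purely polynomial.\<close>

lemma wronskian_identity:
  fixes V v \<mu> k c p q e :: complex
  assumes "V * v = 1" and "s * s = 1" and "i * i = -1"
  shows "(q - (- i * s * \<mu> * v) * p) * (- \<mu> * e)
      + (s * (i * (\<mu> * \<mu>) * v * p + c * (1 - (k * k) * (v * v)) * e)
         - (- i * s * \<mu> * v) * (s * (- i * V * q - c * (- i * s * \<mu> * v) * e))) * e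
      = s * c * (1 - (k * k + \<mu> * \<mu>) * (v * v)) * (e * e)"
  using assms by algebra

text \<open>As \<kappa>^2 = - \<mu>^2 / V^2, this is u2^2 + u3^2 - u1^2 for the mode u = (k/V,
  \<kappa>, 1) exp (- \<mu> t) at t = 0.\<close>

definition wronskian_slope :: "complex \<Rightarrow> complex \<Rightarrow> complex \<Rightarrow> complex" where
  "wronskian_slope k V \<mu> = 1 - (k\<^sup>2 + \<mu>\<^sup>2) / V\<^sup>2"

text \<open>One half-line in the coordinate \<open>t = s x \<ge> 0\<close>, with \<open>P = u\<^sub>3\<close>, \<open>Q = u\<^sub>2\<close> and
  right-hand side \<open>c\<close> times the eigenfunction.  \<open>\<mu>\<close> with real part \<open>0\<close> is admitted, so that
  \<open>W \<in> [k\<^sup>2, \<infinity>)\<close> can be excluded.\<close>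

locale half_line =
  fixes s :: real and V \<mu> k c :: complex and P Q :: "real \<Rightarrow> complex"
  assumes s: "s = 1 \<or> s = -1" and V: "V \<noteq> 0" and mu: "Re \<mu> \<ge> 0"
    and P: "square_integrable P" and Q: "square_integrable Q"
    and dP: "\<And>t. t \<ge> 0 \<Longrightarrow> ((\<lambda>t. P (s * t)) has_vector_derivative
      of_real s * (- \<i> * V * Q (s * t) - c * (- \<i> * of_real s * \<mu> / V) * exp (- \<mu> * of_real t)))
      (at t within {0..})"
    and dQ: "\<And>t. t \<ge> 0 \<Longrightarrow> ((\<lambda>t. Q (s * t)) has_vector_derivative
      of_real s * (\<i> * \<mu>\<^sup>2 / V * P (s * t) + c * (1 - k\<^sup>2 / V\<^sup>2) * exp (- \<mu> * of_real t)))
      (at t within {0..})"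
begin

abbreviation "\<kappa> \<equiv> - \<i> * of_real s * \<mu> / V"

lemma s_squared: "complex_of_real s * of_real s = 1"
  using s by auto

lemma wronskian:
  assumes "t \<ge> 0"
  shows "((\<lambda>t. (Q (s * t) - \<kappa> * P (s * t)) * exp (- \<mu> * of_real t)) has_vector_derivative
    of_real s * c * wronskian_slope k V \<mu> * exp (- (2 * \<mu>) * of_real t)) (at t within {0..})"
proof -
  define e where "e = exp (- \<mu> * of_real t)"
  have e2: "exp (- (2 * \<mu>) * of_real t) = e * e"
    by (simp add: e_def mult.assoc flip: exp_add)
  let ?q' = "of_real s * (\<i> * \<mu>\<^sup>2 / V * P (s * t) + c * (1 - k\<^sup>2 / V\<^sup>2) * e)"
  let ?p' = "of_real s * (- \<i> * V * Q (s * t) - c * \<kappa> * e)"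
  have ident: "(Q (s * t) - \<kappa> * P (s * t)) * (- \<mu> * e) + (?q' - \<kappa> * ?p') * e
      = of_real s * c * wronskian_slope k V \<mu> * (e * e)"
    unfolding wronskian_slope_def power2_eq_square divide_inverse inverse_mult_distrib
    by (rule wronskian_identity) (use V s_squared in simp_all)
  have "((\<lambda>t. (Q (s * t) - \<kappa> * P (s * t)) * exp (- \<mu> * of_real t)) has_vector_derivative
      (Q (s * t) - \<kappa> * P (s * t)) * (- \<mu> * e) + (?q' - \<kappa> * ?p') * e) (at t within {0..})"
    unfolding e_def
    by (intro has_vector_derivative_mult has_vector_derivative_diff has_vector_derivative_mult_right
        exp_has_vector_derivative dP dQ assms)
  then show ?thesis unfolding ident e2 .
qed

lemma square_integrable_Q_minus: "square_integrable (\<lambda>x. Q x - \<kappa> * P x)"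
  using square_integrable_add[OF Q square_integrable_cmult[OF P, of "- \<kappa>"]] by simp

lemma norm_Q_minus_ge:
  assumes "t \<ge> 0"
  shows "norm ((Q (s * t) - \<kappa> * P (s * t)) * exp (- \<mu> * of_real t)) \<le> norm (Q (s * t) - \<kappa> * P (s * t))"
  using mult_left_mono[OF norm_exp_le_1[OF mu assms], of "norm (Q (s * t) - \<kappa> * P (s * t))"]
  by (simp add: norm_mult)

text \<open>The exponential has modulus at most 1, so the square integrable Q - \<kappa> P dominates
  the constant Wronskian. This argument needs no decay and covers \<open>Re \<mu> = 0\<close> as
  well.\<close>

lemma homogeneous:
  assumes "c = 0"
  shows "t \<ge> 0 \<Longrightarrow> P (s * t) = P 0 * exp (- \<mu> * of_real t)"
    and "t \<ge> 0 \<Longrightarrow> Q (s * t) = \<kappa> * P (s * t)"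
    and "Re \<mu> = 0 \<Longrightarrow> P 0 = 0"
proof -
  have const: "(Q (s * t) - \<kappa> * P (s * t)) * exp (- \<mu> * of_real t) = Q 0 - \<kappa> * P 0" if "t \<ge> 0" for t
    using constant_on_half_line[of "\<lambda>t. (Q (s * t) - \<kappa> * P (s * t)) * exp (- \<mu> * of_real t)" t]
      wronskian that assms by simp
  have "norm (Q 0 - \<kappa> * P 0) \<le> 0"
  proof (rule square_integrable_half_line_bound[OF square_integrable_Q_minus s])
    show "norm (Q 0 - \<kappa> * P 0) \<le> norm (Q (s * t) - \<kappa> * P (s * t))" if "t \<ge> 0" for t
      using norm_Q_minus_ge[OF that] unfolding const[OF that] .
  qed
  then have QP: "Q (s * t) = \<kappa> * P (s * t)" if "t \<ge> 0" for t
  proof -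
    have "(Q (s * t) - \<kappa> * P (s * t)) * exp (- \<mu> * of_real t) = 0"
      using const[OF that] \<open>norm (Q 0 - \<kappa> * P 0) \<le> 0\<close> by (simp only: norm_le_zero_iff)
    then show ?thesis by (simp only: mult_eq_0_iff exp_not_eq_zero right_minus_eq simp_thms)
  qed
  \<comment> \<open>Once Q = \<kappa> P, the first equation is P' = - \<mu> P in the variable t,
    with this integrating factor.\<close>
  have "((\<lambda>t. P (s * t) * exp (\<mu> * of_real t)) has_vector_derivative 0) (at t within {0..})"
    if "t \<ge> 0" for t
  proof -
    have "((\<lambda>t. P (s * t) * exp (\<mu> * of_real t)) has_vector_derivative
      P (s * t) * (\<mu> * exp (\<mu> * of_real t)) + (of_real s * (- \<i> * V * Q (s * t))) * exp (\<mu> * of_real t))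
      (at t within {0..})"
      using dP[OF that] assms by (intro has_vector_derivative_mult exp_has_vector_derivative) simp
    moreover have "of_real s * (- \<i> * V * Q (s * t)) = - \<mu> * P (s * t)"
      using V s by (auto simp: QP[OF that])
    ultimately show ?thesis by simp
  qed
  then have P0: "P (s * t) * exp (\<mu> * of_real t) = P 0" if "t \<ge> 0" for t
    using constant_on_half_line[of "\<lambda>t. P (s * t) * exp (\<mu> * of_real t)" t] that by simp
  then have P_exp: "P (s * t) = P 0 * exp (- \<mu> * of_real t)" if "t \<ge> 0" for t
    by (subst P0[OF that, symmetric]) (simp add: mult.assoc flip: exp_add)
  \<comment> \<open>The modulus of P is then constant along the ray.\<close>
  show "P 0 = 0" if "Re \<mu> = 0"
    using square_integrable_half_line_bound[OF P s, of 0 "norm (P 0)"] that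
    by (simp add: P_exp norm_mult)
  show "t \<ge> 0 \<Longrightarrow> P (s * t) = P 0 * exp (- \<mu> * of_real t)" "t \<ge> 0 \<Longrightarrow> Q (s * t) = \<kappa> * P (s * t)"
    by (fact P_exp QP)+
qed

text \<open>The Wronskian has a limit at infinity, which must be 0, since otherwise |Q - \<kappa> P|
  would stay away from 0. Integrating back from infinity gives its value at 0, which is all that
  matching the two sides requires.\<close>

lemma inhomogeneous:
  assumes "Re \<mu> > 0"
  shows "Q 0 - \<kappa> * P 0 = - (of_real s * c * wronskian_slope k V \<mu> / (2 * \<mu>))"
proof -
  \<comment> \<open>\<open>- D * exp (- 2 * \<mu> * t)\<close> is an antiderivative of the
    derivative found in \<open>wronskian\<close>.\<close>
  define D where "D = of_real s * c * wronskian_slope k V \<mu> / (2 * \<mu>)"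
  define w where "w t = (Q (s * t) - \<kappa> * P (s * t)) * exp (- \<mu> * of_real t)" for t
  have "\<mu> \<noteq> 0" using assms by auto
  have "((\<lambda>t. w t + D * exp (- (2 * \<mu>) * of_real t)) has_vector_derivative 0) (at t within {0..})" if "t \<ge> 0" for t
  proof -
    have "((\<lambda>t. w t + D * exp (- (2 * \<mu>) * of_real t)) has_vector_derivative
      of_real s * c * wronskian_slope k V \<mu> * exp (- (2 * \<mu>) * of_real t)
        + D * (- (2 * \<mu>) * exp (- (2 * \<mu>) * of_real t))) (at t within {0..})"
      unfolding w_def
      by (intro has_vector_derivative_add wronskian that has_vector_derivative_mult_right exp_has_vector_derivative)
    then show ?thesis using \<open>\<mu> \<noteq> 0\<close> by (simp add: D_def)
  qed
  then have w: "w t + D * exp (- (2 * \<mu>) * of_real t) = w 0 + D" if "t \<ge> 0" for t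
    using constant_on_half_line[of "\<lambda>t. w t + D * exp (- (2 * \<mu>) * of_real t)" t] that by simp
  have "((\<lambda>t. w 0 + D - D * exp (- (2 * \<mu>) * of_real t)) \<longlongrightarrow> w 0 + D - D * 0) at_top"
    by (intro tendsto_intros exp_decay) (use assms in simp)
  moreover have "\<forall>\<^sub>F t in at_top. w 0 + D - D * exp (- (2 * \<mu>) * of_real t) = w t"
    using eventually_ge_at_top[of "0::real"]
  proof eventually_elim
    case (elim t)
    from w[OF elim] show ?case by (simp only: diff_eq_eq)
  qed
  ultimately have lim: "(w \<longlongrightarrow> w 0 + D) at_top"
    using Lim_transform_eventually by fastforce
  have "w 0 + D = 0"
  proof (rule ccontr)
    assume "w 0 + D \<noteq> 0"
    then have "\<forall>\<^sub>F t in at_top. norm (w t) > norm (w 0 + D) / 2"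
      by (intro order_tendstoD(1)[OF tendsto_norm[OF lim]]) simp
    then obtain T where T: "\<And>t. t \<ge> T \<Longrightarrow> norm (w t) > norm (w 0 + D) / 2"
      by (auto simp: eventually_at_top_linorder)
    have "norm (w 0 + D) / 2 \<le> 0"
    proof (rule square_integrable_half_line_bound[OF square_integrable_Q_minus s])
      fix t assume "t \<ge> max T 0"
      then show "norm (w 0 + D) / 2 \<le> norm (Q (s * t) - \<kappa> * P (s * t))"
        using T[of t] norm_Q_minus_ge[of t] by (simp add: w_def)
    qed
    with \<open>w 0 + D \<noteq> 0\<close> show False by simp
  qed
  then show ?thesis by (simp add: w_def D_def eq_neg_iff_add_eq_0)
qed

end

text \<open>Upgrades an equation valid almost everywhere to a classical one: a primitive of a
  function that agrees almost everywhere with a continuous \<open>h\<close> is differentiable with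
  derivative \<open>h\<close>, one-sidedly at 0.\<close>

lemma primitive_half_line_derivative:
  fixes F g h :: "real \<Rightarrow> complex"
  assumes F: "\<And>a b. a \<le> b \<Longrightarrow> (g has_integral (F b - F a)) {a..b}"
    and s: "s = 1 \<or> s = -1"
    and g: "AE x in lebesgue. s * x > 0 \<longrightarrow> g x = h (s * x)"
    and h: "continuous_on {0..} h" and t: "t \<ge> 0"
  shows "((\<lambda>t. F (s * t)) has_vector_derivative of_real s * h t) (at t within {0..})"
proof -
  have int: "(h has_integral of_real s * (F (s * b) - F 0)) {0..b}" if "b \<ge> 0" for b
  proof -
    have g': "AE x in lborel. s * x > 0 \<longrightarrow> g x = h (s * x)"
      using g by (simp add: AE_completion_iff)
    have "AE x in lborel. x \<noteq> (0::real)" by (rule AE_lborel_singleton)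
    consider "s = 1" | "s = -1" using s by blast
    then show ?thesis
    proof cases
      case 1
      have "(g has_integral (F b - F 0)) {0..b}" by (rule F[OF that])
      moreover have "AE x in lborel. x \<in> {0..b} \<longrightarrow> g x = h x"
        using g' \<open>AE x in lborel. x \<noteq> 0\<close> by eventually_elim (use 1 in auto)
      ultimately have "(h has_integral (F b - F 0)) {0..b}"
        by (simp only: has_integral_AE[of "{0..b}" g h])
      then show ?thesis using 1 by simp
    next
      case 2
      have "(g has_integral (F 0 - F (-b))) {-b..0}" using F[of "-b" 0] that by simp
      moreover have "AE x in lborel. x \<in> {-b..0} \<longrightarrow> g x = h (- x)"
        using g' \<open>AE x in lborel. x \<noteq> 0\<close> by eventually_elim (use 2 in auto)
      ultimately have "((\<lambda>x. h (- x)) has_integral (F 0 - F (-b))) {-b..0}"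
        by (simp only: has_integral_AE[of "{-b..0}" g "\<lambda>x. h (- x)"])
      then have "(h has_integral (F 0 - F (-b))) {0..b}"
        using has_integral_reflect_real[of h _ b 0] by simp
      then show ?thesis using 2 by simp
    qed
  qed
  have "((\<lambda>u. integral {0..u} h) has_vector_derivative h t) (at t within {0..t + 1})"
    by (rule integral_has_vector_derivative[OF continuous_on_subset[OF h]]) (use t in auto)
  moreover have "at t within {0..t + 1} = at t within {0..}"
    by (rule at_within_nhd[of t "{..<t + 1}"]) auto
  ultimately have "((\<lambda>u. integral {0..u} h) has_vector_derivative h t) (at t within {0..})"
    by simp
  then have "((\<lambda>u. F 0 + of_real s * integral {0..u} h) has_vector_derivative of_real s * h t) (at t within {0..})"
    using has_vector_derivative_add[OF has_vector_derivative_const has_vector_derivative_mult_right] by fastforce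
  then show ?thesis
  proof (rule has_vector_derivative_transform[rotated 2])
    fix u :: real assume "u \<in> {0..}"
    with int[of u] have "integral {0..u} h = of_real s * (F (s * u) - F 0)" by (auto dest: integral_unique)
    then show "F (s * u) = F 0 + of_real s * integral {0..u} h" using s by auto
  qed (use t in simp)
qed

section \<open>Exponentially decaying layers\<close>

text \<open>Closed under differentiation, with the linear term reserved for the generalized
  modes.\<close>

definition decay :: "complex \<Rightarrow> complex \<Rightarrow> complex \<Rightarrow> real \<Rightarrow> complex" where
  "decay m a b t = (a + b * of_real t) * exp (- m * of_real t)"

lemma decay_0 [simp]: "decay m a b 0 = a"
  by (simp add: decay_def)

lemma decay_has_vector_derivative:
  "(decay m a b has_vector_derivative decay m (b - m * a) (- m * b) t) (at t within S)"
proof -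
  have "((\<lambda>t. a + b * complex_of_real t) has_vector_derivative b) (at t within S)"
    by (rule has_vector_derivative_real_field) (auto intro!: derivative_eq_intros)
  from has_vector_derivative_mult[OF this exp_has_vector_derivative[of "- m" t S]]
  show ?thesis
    unfolding decay_def[abs_def] by (simp add: algebra_simps)
qed

lemma continuous_on_decay: "continuous_on S (decay m a b)"
  unfolding decay_def[abs_def] by (intro continuous_intros)

text \<open>Half of the decay rate pays for the linear factor, through r t \<le> exp (r t).\<close>

lemma norm_decay_le:
  assumes "0 < r" "2 * r \<le> Re m" "t \<ge> 0"
  shows "norm (decay m a b t) \<le> (norm a + norm b / r) * exp (- r * t)"
proof -
  have "r * t \<le> exp (r * t)" using exp_ge_add_one_self[of "r * t"] by linarith
  then have t: "t \<le> exp (r * t) / r" using assms(1) by (simp add: field_simps)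
  have 1: "1 \<le> exp (r * t)" using assms by simp
  have "norm (a + b * of_real t) \<le> norm a + norm b * t"
    using norm_triangle_ineq[of a "b * of_real t"] assms(3) by (simp add: norm_mult)
  also have "\<dots> \<le> norm a * exp (r * t) + norm b * (exp (r * t) / r)"
    using mult_left_mono[OF 1, of "norm a"] mult_left_mono[OF t, of "norm b"] by simp
  also have "\<dots> = (norm a + norm b / r) * exp (r * t)" by (simp add: algebra_simps)
  finally have 2: "norm (a + b * of_real t) \<le> (norm a + norm b / r) * exp (r * t)" .
  have "norm (exp (- m * of_real t)) \<le> exp (- (2 * r) * t)"
    using mult_right_mono[OF assms(2,3)] by simp
  then have "norm (decay m a b t) \<le> ((norm a + norm b / r) * exp (r * t)) * exp (- (2 * r) * t)"
    unfolding decay_def norm_mult using 2 assms(1) by (intro mult_mono) auto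
  also have "\<dots> = (norm a + norm b / r) * exp (- r * t)"
    by (simp add: mult.assoc algebra_simps flip: exp_add)
  finally show ?thesis .
qed

definition layer :: "(real \<Rightarrow> complex) \<Rightarrow> (real \<Rightarrow> complex) \<Rightarrow> real \<Rightarrow> complex" where
  "layer f g x = (if x > 0 then f x else g (- x))"

lemma square_integrable_exp_abs:
  assumes "r > 0"
  shows "square_integrable (\<lambda>x::real. exp (- r * \<bar>x\<bar>))"
  unfolding square_integrable_def
proof
  show m: "(\<lambda>x::real. exp (- r * \<bar>x\<bar>)) \<in> borel_measurable lebesgue"
    by (intro measurable_completion) simp
  define i where "i x = indicator {0..} x * exp (- (2 * r) * x)" for x :: real
  have "(\<lambda>x. exp (- (2 * r) * x)) absolutely_integrable_on {0..}"
    by (intro nonnegative_absolutely_integrable_1)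
      (use has_integral_exp_minus_to_infinity[of "2 * r" 0] assms in auto)
  then have i: "integrable lebesgue i"
    by (simp add: set_integrable_def i_def[abs_def])
  then have "integrable lebesgue (\<lambda>x. i (- x))"
    using lebesgue_integrable_real_affine[of i "-1" 0] by simp
  with i have "integrable lebesgue (\<lambda>x. i x + i (- x))" by simp
  then show "integrable lebesgue (\<lambda>x. (norm (exp (- r * \<bar>x\<bar>)))\<^sup>2)"
  proof (rule Bochner_Integration.integrable_bound)
    show "(\<lambda>x. (norm (exp (- r * \<bar>x\<bar>)))\<^sup>2) \<in> borel_measurable lebesgue"
      by (intro measurable_completion) simp
    \<comment> \<open>Only an inequality, because both halves contribute at x = 0.\<close>
    have "(exp (- r * \<bar>x\<bar>))\<^sup>2 \<le> \<bar>i x + i (- x)\<bar>" for x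
      by (simp add: i_def power2_eq_square indicator_def flip: exp_add)
    then show "AE x in lebesgue. norm ((norm (exp (- r * \<bar>x\<bar>)))\<^sup>2) \<le> norm (i x + i (- x))"
      by simp
  qed
qed

lemma square_integrable_layer_decay:
  assumes "Re m > 0" "Re m' > 0"
  shows "square_integrable (layer (decay m a b) (decay m' a' b'))"
proof -
  define r where "r = min (Re m) (Re m') / 2"
  have r: "0 < r" "2 * r \<le> Re m" "2 * r \<le> Re m'" using assms by (auto simp: r_def)
  define C where "C = max (norm a + norm b / r) (norm a' + norm b' / r)"
  show ?thesis
  proof (rule square_integrable_bound[OF square_integrable_exp_abs[OF r(1)]])
    have "decay m a b \<in> borel_measurable borel" "(\<lambda>x. decay m' a' b' (- x)) \<in> borel_measurable borel"
      by (intro borel_measurable_continuous_onI continuous_on_decay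
          continuous_on_compose2[OF continuous_on_decay[of UNIV]] continuous_intros subset_UNIV)+
    then have "layer (decay m a b) (decay m' a' b') \<in> borel_measurable borel"
      unfolding layer_def[abs_def] by (intro measurable_If) auto
    then show "layer (decay m a b) (decay m' a' b') \<in> borel_measurable lebesgue"
      by (intro measurable_completion) simp
    show "norm (layer (decay m a b) (decay m' a' b') x) \<le> C * norm (exp (- r * \<bar>x\<bar>))" for x
    proof (cases "x > 0")
      case True
      have "norm (decay m a b x) \<le> (norm a + norm b / r) * exp (- r * x)"
        by (rule norm_decay_le[OF r(1,2)]) (use True in simp)
      also have "\<dots> \<le> C * exp (- r * x)" by (intro mult_right_mono) (auto simp: C_def)
      finally show ?thesis using True by (simp add: layer_def)
    next
      case False
      have "norm (decay m' a' b' (- x)) \<le> (norm a' + norm b' / r) * exp (- r * (- x))"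
        by (rule norm_decay_le[OF r(1,3)]) (use False in simp)
      also have "\<dots> \<le> C * exp (- r * (- x))" by (intro mult_right_mono) (auto simp: C_def)
      finally show ?thesis using False by (simp add: layer_def)
    qed
  qed
qed

lemma continuous_on_layer:
  assumes "continuous_on UNIV f" "continuous_on UNIV g" "f 0 = g 0"
  shows "continuous_on UNIV (layer f g)"
proof -
  have "continuous_on ({0..} \<union> {..0}) (\<lambda>x. if x \<ge> 0 then f x else g (- x))"
    by (intro continuous_on_cases continuous_on_subset[OF assms(1)]
        continuous_on_compose2[OF assms(2)] continuous_intros) (use assms(3) in auto)
  moreover have "{0..} \<union> {..0} = (UNIV :: real set)" by auto
  moreover have "layer f g x = (if x \<ge> 0 then f x else g (- x))" for x
    using assms(3) by (cases "x = 0") (auto simp: layer_def)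
  ultimately show ?thesis by simp
qed

text \<open>Both sides share the value \<open>a\<close> at 0; a jump would add a point mass to the
  derivative.\<close>

lemma is_weak_deriv_layer_decay:
  assumes "Re m > 0" "Re m' > 0"
  shows "is_weak_deriv (layer (decay m a b) (decay m' a b'))
    (layer (decay m (b - m * a) (- m * b)) (decay m' (m' * a - b') (m' * b')))"
proof (rule is_weak_deriv_primitive)
  let ?F = "layer (decay m a b) (decay m' a b')"
  let ?G = "layer (decay m (b - m * a) (- m * b)) (decay m' (m' * a - b') (m' * b'))"
  show "locally_integrable ?G"
    by (intro square_integrable_locally_integrable square_integrable_layer_decay assms)
  fix x y :: real assume "x \<le> y"
  show "(?G has_integral ?F y - ?F x) {x..y}"
  proof (rule fundamental_theorem_of_calculus_interior_strong[of "{0}"])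
    show "continuous_on {x..y} ?F"
      by (rule continuous_on_subset[OF continuous_on_layer]) (auto intro: continuous_on_decay)
    fix t assume "t \<in> {x<..<y} - {0}"
    then consider "t > 0" | "t < 0" by force
    then show "(?F has_vector_derivative ?G t) (at t)"
    proof cases
      case 1
      have "(decay m a b has_vector_derivative ?G t) (at t)"
        using decay_has_vector_derivative[of m a b t UNIV] 1 by (simp add: layer_def)
      then show ?thesis
        by (rule has_vector_derivative_transform_within_open[of _ _ _ "{0<..}"]) (use 1 in \<open>auto simp: layer_def\<close>)
    next
      case 2
      have "((\<lambda>x. decay m' a b' (- x)) has_vector_derivative
          (-1) *\<^sub>R decay m' (b' - m' * a) (- m' * b') (- t)) (at t)"
        by (rule vector_diff_chain_at[where f = uminus, unfolded o_def])
          (use decay_has_vector_derivative[of m' a b' "- t" UNIV] in \<open>auto intro!: derivative_eq_intros\<close>)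
      moreover have "(-1) *\<^sub>R decay m' (b' - m' * a) (- m' * b') (- t) = ?G t"
        using 2 by (simp add: layer_def decay_def algebra_simps)
      ultimately have "((\<lambda>x. decay m' a b' (- x)) has_vector_derivative ?G t) (at t)" by simp
      then show ?thesis
        by (rule has_vector_derivative_transform_within_open[of _ _ _ "{..<0}"]) (use 2 in \<open>auto simp: layer_def\<close>)
    qed
  qed (use \<open>x \<le> y\<close> in auto)
qed

section \<open>Square integrable fields and the pencil\<close>

lemma L2_eq_refl_iff: "L2_eq f f \<longleftrightarrow> square_integrable f"
  by (simp add: L2_eq_def)

lemma abs_L2_eq_iff:
  assumes "square_integrable f" "square_integrable g"
  shows "abs_L2 f = abs_L2 g \<longleftrightarrow> (AE x in lebesgue. f x = g x)"
  using Quotient3_rel[OF Quotient3_L2, of f g] assms by (auto simp: L2_eq_def)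

lemma rep_abs_L2:
  assumes "square_integrable f"
  shows "AE x in lebesgue. rep_L2 (abs_L2 f) x = f x"
  using Quotient3_rep_abs[OF Quotient3_L2, of f] assms by (auto simp: L2_eq_def)

lemma abs_rep_L2: "abs_L2 (rep_L2 u) = u"
  by (rule Quotient3_abs_rep[OF Quotient3_L2])

lemma square_integrable_vector_diff:
  fixes f g :: "real \<Rightarrow> complex ^ 3"
  assumes "square_integrable f" "square_integrable g"
  shows "square_integrable (\<lambda>x. f x - g x)"
  using square_integrable_add[OF assms(1) square_integrable_scale[OF assms(2), of "-1"]]
  by (simp add: vector_sneg_minus1[symmetric])

lemma abs_L2_diff:
  assumes "square_integrable f" "square_integrable g"
  shows "abs_L2 f - abs_L2 g = abs_L2 (\<lambda>x. f x - g x)"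
proof -
  have m: "square_integrable (\<lambda>x. - g x)"
    using square_integrable_scale[OF assms(2), of "-1"] by (simp add: vector_sneg_minus1[symmetric])
  have "- abs_L2 g = abs_L2 (\<lambda>x. - g x)"
    by (rule uminus_L2.abs_eq) (simp add: L2_eq_refl_iff assms)
  moreover have "abs_L2 f + abs_L2 (\<lambda>x. - g x) = abs_L2 (\<lambda>x. f x + - g x)"
    by (rule plus_L2.abs_eq) (simp_all add: L2_eq_refl_iff assms m)
  ultimately show ?thesis by (simp add: minus_L2_def)
qed

lemma L2_eqI:
  assumes "\<And>i. AE x in lebesgue. component u i x = component v i x"
  shows "u = v"
proof -
  have "AE x in lebesgue. rep_L2 u x = rep_L2 v x"
    using assms[of 1] assms[of 2] assms[of 3]
    by eventually_elim (simp add: component_def vec_eq_iff forall_3)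
  then have "abs_L2 (rep_L2 u) = abs_L2 (rep_L2 v)"
    by (simp add: abs_L2_eq_iff square_integrable_rep)
  then show ?thesis by (simp add: abs_rep_L2)
qed

lemma component_zero: "AE x in lebesgue. component 0 i x = 0"
  using rep_abs_L2[OF square_integrable_zero]
  by (auto simp: component_def zero_L2_def elim: eventually_mono)

lemma component_scale: "AE x in lebesgue. component (scale_L2 c u) i x = c * component u i x"
proof -
  have "scale_L2 c (abs_L2 (rep_L2 u)) = abs_L2 (\<lambda>x. c *s rep_L2 u x)"
    by (rule scale_L2.abs_eq) (simp add: L2_eq_refl_iff square_integrable_rep)
  then have "scale_L2 c u = abs_L2 (\<lambda>x. c *s rep_L2 u x)" by (simp add: abs_rep_L2)
  then show ?thesis
    using rep_abs_L2[OF square_integrable_scale[OF square_integrable_rep[of u], of c]]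
    by (auto simp: component_def elim: eventually_mono)
qed

text \<open>\<open>abs_L2\<close> is meaningful only on square integrable functions, which is what
  membership in \<open>dom_A\<close> guarantees for the weak derivatives.\<close>

lemma pencil_eq_iff:
  assumes u: "u \<in> dom_A"
  shows "pencil (two_layer Vp Vm) k \<omega> u = v \<longleftrightarrow> (AE x in lebesgue.
    \<i> * of_real k * component u 3 x - \<i> * two_layer Vp Vm x \<omega> * component u 1 x = component v 1 x \<and>
    - weak_deriv (component u 3) x - \<i> * two_layer Vp Vm x \<omega> * component u 2 x = component v 2 x \<and>
    - \<i> * of_real k * component u 1 x + weak_deriv (component u 2) x - \<i> * \<omega> * component u 3 x
      = component v 3 x)"
proof -
  note si = op_A_square_integrable[OF u, of k] op_B_square_integrable[of Vp Vm \<omega> u]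
  have "pencil (two_layer Vp Vm) k \<omega> u = v \<longleftrightarrow> pencil (two_layer Vp Vm) k \<omega> u = abs_L2 (rep_L2 v)"
    by (simp add: abs_rep_L2)
  also have "\<dots> \<longleftrightarrow> (AE x in lebesgue. (vector
     [ \<i> * of_real k * component u 3 x,
       - weak_deriv (component u 3) x,
       - \<i> * of_real k * component u 1 x + weak_deriv (component u 2) x ] :: complex ^ 3) - vector
     [ \<i> * two_layer Vp Vm x \<omega> * component u 1 x,
       \<i> * two_layer Vp Vm x \<omega> * component u 2 x,
       \<i> * \<omega> * component u 3 x ] = rep_L2 v x)"
    unfolding pencil_def op_A_def op_B_def abs_L2_diff[OF si]
    by (rule abs_L2_eq_iff[OF square_integrable_vector_diff[OF si] square_integrable_rep])
  finally show ?thesis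
    by (simp add: vec_eq_iff forall_3 component_def)
qed

lemma component_abs_L2:
  fixes f :: "3 \<Rightarrow> real \<Rightarrow> complex"
  assumes f: "\<And>i. square_integrable (f i)"
    and g: "square_integrable g2" "square_integrable g3"
    and fg: "is_weak_deriv (f 2) g2" "is_weak_deriv (f 3) g3"
  defines "u \<equiv> abs_L2 (\<lambda>x. vector [f 1 x, f 2 x, f 3 x])"
  shows "u \<in> dom_A" "AE x in lebesgue. component u i x = f i x"
    "AE x in lebesgue. weak_deriv (component u 2) x = g2 x"
    "AE x in lebesgue. weak_deriv (component u 3) x = g3 x"
proof -
  note li = square_integrable_locally_integrable
  have c: "AE x in lebesgue. component u i x = f i x" for i
    using rep_abs_L2[OF square_integrable_vector_3[OF f f f, of 1 2 3]] exhaust_3[of i]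
    by (auto simp: u_def component_def elim!: eventually_mono)
  then show "AE x in lebesgue. component u i x = f i x" .
  have wd: "is_weak_deriv (component u i) g" if "is_weak_deriv (f i) g" "square_integrable g" for i g
    by (rule is_weak_deriv_cong_AE[OF _ _ _ _ _ _ that(1)])
      (use c[of i] that(2) in \<open>auto intro: li f square_integrable_component elim: eventually_mono\<close>)
  have H: "component u i \<in> H1" if "is_weak_deriv (f i) g" "square_integrable g" for i g
    using wd[OF that] that by (auto simp: H1_def square_integrable_component)
  show "u \<in> dom_A"
    using H fg g by (auto simp: dom_A_def)
  show "AE x in lebesgue. weak_deriv (component u 2) x = g2 x"
    by (rule is_weak_deriv_unique[OF li li weak_deriv_H1(2) wd]) (use H fg g in \<open>auto intro: weak_deriv_H1\<close>)
  show "AE x in lebesgue. weak_deriv (component u 3) x = g3 x"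
    by (rule is_weak_deriv_unique[OF li li weak_deriv_H1(2) wd]) (use H fg g in \<open>auto intro: weak_deriv_H1\<close>)
qed

text \<open>A root with zero real part has a nonpositive real square, and conversely for the
  principal root.\<close>

lemma Re_csqrt_pos_iff: "Re (csqrt z) > 0 \<longleftrightarrow> z \<notin> complex_of_real ` {..0}"
proof -
  have "Re (csqrt z) = 0 \<longleftrightarrow> z \<in> complex_of_real ` {..0}"
  proof
    assume 0: "Re (csqrt z) = 0"
    have "z = (csqrt z)\<^sup>2" by simp
    also have "\<dots> = complex_of_real (- (Im (csqrt z))\<^sup>2)"
      using 0 by (intro complex_eqI) (simp_all add: power2_eq_square)
    finally show "z \<in> complex_of_real ` {..0}" by (rule image_eqI) simp
  qed auto
  moreover have "Re (csqrt z) \<ge> 0" using csqrt_principal[of z] by linarith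
  ultimately show ?thesis by (auto simp: less_le)
qed

section \<open>The two-layer problem and its reduction to half-lines\<close>

locale two_layers =
  fixes Vp Vm :: "complex \<Rightarrow> complex" and k :: real and \<omega> :: complex
  assumes Vp: "Vp \<omega> \<noteq> 0" and Vm: "Vm \<omega> \<noteq> 0"
begin

abbreviation V :: "real \<Rightarrow> complex" where
  "V x \<equiv> two_layer Vp Vm x \<omega>"

text \<open>The argument is the sign 1 or -1 of a half-line; evaluating \<open>V\<close> at that
  point selects the layer. The radicand is k^2 - W.\<close>

definition \<mu> :: "real \<Rightarrow> complex" where
  "\<mu> s = csqrt (of_real (k\<^sup>2) + \<omega> * V s)"

definition \<kappa> :: "real \<Rightarrow> complex" where
  "\<kappa> s = - \<i> * of_real s * \<mu> s / V s"

text \<open>As 1/(2 \<mu>) is the integral of exp (- 2 \<mu> t) over t > 0, this is the integral of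
  u2^2 + u3^2 - u1^2 over the line for the normalized mode.\<close>

definition slope_sum :: complex where
  "slope_sum = wronskian_slope (of_real k) (V 1) (\<mu> 1) / (2 * \<mu> 1)
     + wronskian_slope (of_real k) (V (-1)) (\<mu> (-1)) / (2 * \<mu> (-1))"

lemma V_nonzero: "V s \<noteq> 0"
  using Vp Vm by (simp add: two_layer_def)

lemma Re_\<mu>: "Re (\<mu> s) \<ge> 0"
  unfolding \<mu>_def using csqrt_principal[of "of_real (k\<^sup>2) + \<omega> * V s"] by linarith

lemma \<mu>_squared: "(\<mu> s)\<^sup>2 = of_real (k\<^sup>2) + \<omega> * V s"
  by (simp add: \<mu>_def)

lemma V_eq: "s = 1 \<or> s = -1 \<Longrightarrow> s * x > 0 \<Longrightarrow> V x = V s"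
  by (auto simp: two_layer_def)

text \<open>One pair \<open>P\<close>, \<open>Q\<close> serves both signs: the interface condition
  is encoded in the shared values \<open>P 0\<close> and \<open>Q 0\<close>.\<close>

lemma half_line_of_solution:
  assumes u: "u \<in> dom_A" and v: "pencil (two_layer Vp Vm) k \<omega> u = v"
    and v1: "\<And>s. s = 1 \<or> s = -1 \<Longrightarrow> AE x in lebesgue. s * x > 0 \<longrightarrow>
      component v 1 x = c * of_real k / V s * exp (- \<mu> s * of_real (s * x))"
    and v2: "\<And>s. s = 1 \<or> s = -1 \<Longrightarrow> AE x in lebesgue. s * x > 0 \<longrightarrow>
      component v 2 x = c * \<kappa> s * exp (- \<mu> s * of_real (s * x))"
    and v3: "\<And>s. s = 1 \<or> s = -1 \<Longrightarrow> AE x in lebesgue. s * x > 0 \<longrightarrow>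
      component v 3 x = c * exp (- \<mu> s * of_real (s * x))"
  obtains P Q where "\<And>s. s = 1 \<or> s = -1 \<Longrightarrow> half_line s (V s) (\<mu> s) (of_real k) c P Q"
    "AE x in lebesgue. component u 3 x = P x" "AE x in lebesgue. component u 2 x = Q x"
proof -
  note li = square_integrable_locally_integrable
  have H: "component u 2 \<in> H1" "component u 3 \<in> H1" using u by (auto simp: dom_A_def)
  note si = square_integrable_component
  obtain P where P: "continuous_on UNIV P" "AE x in lebesgue. component u 3 x = P x"
    "\<And>a b. a \<le> b \<Longrightarrow> (weak_deriv (component u 3) has_integral (P b - P a)) {a..b}"
    by (rule weak_deriv_primitive[OF li[OF si] li[OF weak_deriv_H1(1)[OF H(2)]] weak_deriv_H1(2)[OF H(2)]]) rule
  obtain Q where Q: "continuous_on UNIV Q" "AE x in lebesgue. component u 2 x = Q x"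
    "\<And>a b. a \<le> b \<Longrightarrow> (weak_deriv (component u 2) has_integral (Q b - Q a)) {a..b}"
    by (rule weak_deriv_primitive[OF li[OF si] li[OF weak_deriv_H1(1)[OF H(1)]] weak_deriv_H1(2)[OF H(1)]]) rule
  have "half_line s (V s) (\<mu> s) (of_real k) c P Q" if s: "s = 1 \<or> s = -1" for s
  proof
    show "s = 1 \<or> s = -1" "V s \<noteq> 0" "Re (\<mu> s) \<ge> 0" by (fact s V_nonzero Re_\<mu>)+
    show "square_integrable P" "square_integrable Q"
      by (rule square_integrable_cong_AE[OF si P(1,2)]) (rule square_integrable_cong_AE[OF si Q(1,2)])
    note eqs = v[unfolded pencil_eq_iff[OF u]]
    have cont: "continuous_on {0..} (\<lambda>t. P (s * t))" "continuous_on {0..} (\<lambda>t. Q (s * t))"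
      by (rule continuous_on_compose2[OF P(1)] continuous_on_compose2[OF Q(1)]; auto intro: continuous_intros)+
    have ss: "s * (s * x) = x" for x using s by auto
    fix t :: real assume t: "t \<ge> 0"
    have "AE x in lebesgue. s * x > 0 \<longrightarrow> weak_deriv (component u 3) x =
        - \<i> * V s * Q (s * (s * x)) - c * (- \<i> * of_real s * \<mu> s / V s) * exp (- \<mu> s * of_real (s * x))"
      using eqs v2[OF s] Q(2)
    proof eventually_elim
      case (elim x)
      show ?case
      proof
        assume x: "s * x > 0"
        have "- weak_deriv (component u 3) x - \<i> * V s * Q x = c * \<kappa> s * exp (- \<mu> s * of_real (s * x))"
          using elim x V_eq[OF s x] by simp
        then show "weak_deriv (component u 3) x =
            - \<i> * V s * Q (s * (s * x)) - c * (- \<i> * of_real s * \<mu> s / V s) * exp (- \<mu> s * of_real (s * x))"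
          unfolding ss \<kappa>_def by algebra
      qed
    qed
    then show "((\<lambda>t. P (s * t)) has_vector_derivative of_real s * (- \<i> * V s * Q (s * t) -
        c * (- \<i> * of_real s * \<mu> s / V s) * exp (- \<mu> s * of_real t))) (at t within {0..})"
      by (intro primitive_half_line_derivative[OF P(3) s _ _ t,
            where h = "\<lambda>t. - \<i> * V s * Q (s * t) - c * (- \<i> * of_real s * \<mu> s / V s) * exp (- \<mu> s * of_real t)"]
          continuous_intros cont)
    have "AE x in lebesgue. s * x > 0 \<longrightarrow> weak_deriv (component u 2) x =
        \<i> * (\<mu> s)\<^sup>2 / V s * P (s * (s * x)) + c * (1 - (of_real k)\<^sup>2 / (V s)\<^sup>2) * exp (- \<mu> s * of_real (s * x))"
      using eqs v1[OF s] v3[OF s] P(2)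
    proof eventually_elim
      case (elim x)
      show ?case
      proof
        assume x: "s * x > 0"
        define e where "e = exp (- \<mu> s * of_real (s * x))"
        define r where "r = inverse (V s)"
        have r: "V s * r = 1" using V_nonzero by (simp add: r_def)
        have 1: "\<i> * of_real k * P x - \<i> * V s * component u 1 x = c * of_real k * r * e"
          and 2: "- \<i> * of_real k * component u 1 x + weak_deriv (component u 2) x - \<i> * \<omega> * P x = c * e"
          using elim x V_eq[OF s x] by (simp_all add: e_def r_def divide_inverse)
        have "\<i> * \<i> = -1" by simp
        \<comment> \<open>Equation \<open>1\<close> is solved for \<open>component u 1\<close>,
          which is then eliminated from \<open>2\<close>.\<close>
        with 1 2 r have "weak_deriv (component u 2) x =
            \<i> * ((of_real k)\<^sup>2 + \<omega> * V s) * r * P x + c * (1 - (of_real k)\<^sup>2 * r\<^sup>2) * e"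
          by algebra
        then show "weak_deriv (component u 2) x = \<i> * (\<mu> s)\<^sup>2 / V s * P (s * (s * x))
            + c * (1 - (of_real k)\<^sup>2 / (V s)\<^sup>2) * exp (- \<mu> s * of_real (s * x))"
          by (simp add: \<mu>_squared ss e_def r_def divide_inverse power_inverse)
      qed
    qed
    then show "((\<lambda>t. Q (s * t)) has_vector_derivative of_real s * (\<i> * (\<mu> s)\<^sup>2 / V s * P (s * t) +
        c * (1 - (of_real k)\<^sup>2 / (V s)\<^sup>2) * exp (- \<mu> s * of_real t))) (at t within {0..})"
      by (intro primitive_half_line_derivative[OF Q(3) s _ _ t,
            where h = "\<lambda>t. \<i> * (\<mu> s)\<^sup>2 / V s * P (s * t) + c * (1 - (of_real k)\<^sup>2 / (V s)\<^sup>2) * exp (- \<mu> s * of_real t)"]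
          continuous_intros cont)
  qed
  with P Q show thesis using that by blast
qed

end

section \<open>Modes and generalized modes\<close>

lemma AE_half_lines:
  assumes "\<And>s. s = 1 \<or> s = -1 \<Longrightarrow> AE x in lebesgue. s * x > 0 \<longrightarrow> R x"
  shows "AE x::real in lebesgue. R x"
proof -
  have "AE x in lebesgue. x \<notin> {0::real}"
    by (intro AE_not_in) (simp flip: negligible_iff_null_sets)
  then show ?thesis
    using assms[of 1, simplified] assms[of "-1", simplified]
    by eventually_elim (auto simp: neq_iff)
qed

text \<open>The third equation for the ansatz linear in t. The coefficient of t vanishes because
  \<mu>^2 = k^2 + w V, and the constant coefficient is 1 exactly by the choice of \<beta>.\<close>

lemma generalized_mode_identity:
  fixes i r s V \<mu> k \<beta> t e w :: complex
  assumes "V * r = 1" and "i * i = -1" and "s * s = 1" and "\<mu> * \<mu> = k * k + w * V"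
    and \<beta>: "2 * \<mu> * \<beta> = i * (V * V + \<mu> * \<mu> - k * k) * r"
  shows "- i * k * ((i * k * (r * r) + k * \<beta> * r * t) * e)
    + s * ((- i * r * s * \<mu> * \<beta> - \<mu> * (i * r * (s * \<beta> + - i * s * \<mu> * r)))
        + - \<mu> * (- i * r * s * \<mu> * \<beta>) * t) * e - i * w * (\<beta> * t * e) = e" (is "?lhs = e")
proof -
  let ?c0 = "- i * k * (i * k * (r * r)) + s * (- i * r * s * \<mu> * \<beta> - \<mu> * (i * r * (s * \<beta> + - i * s * \<mu> * r)))"
  let ?c1 = "- i * k * (k * \<beta> * r) + s * (- \<mu> * (- i * r * s * \<mu> * \<beta>)) - i * w * \<beta>"
  have "?c0 = k * k * (r * r) - i * r * (2 * \<mu> * \<beta>) - \<mu> * \<mu> * (r * r)"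
    using assms(2,3) by algebra
  also have "\<dots> = 1" unfolding \<beta> using assms(1,2) by algebra
  finally have c0: "?c0 = 1" .
  have c1: "?c1 = 0" using assms(1-4) by algebra
  have "?lhs = (?c0 + ?c1 * t) * e" by algebra
  then show ?thesis unfolding c0 c1 by simp
qed

context two_layers
begin

text \<open>\<open>c\<close> is the amplitude of the third component. No dispersion relation is
  demanded, so \<open>is_mode 0 0\<close> lets the homogeneous equation be treated as the case of
  right-hand side 0.\<close>

definition is_mode :: "complex \<Rightarrow> L2 \<Rightarrow> bool" where
  "is_mode c u \<longleftrightarrow> (\<forall>s. s = 1 \<or> s = -1 \<longrightarrow> (AE x in lebesgue. s * x > 0 \<longrightarrow>
     component u 1 x = c * of_real k / V s * exp (- \<mu> s * of_real (s * x)) \<and>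
     component u 2 x = c * \<kappa> s * exp (- \<mu> s * of_real (s * x)) \<and>
     component u 3 x = c * exp (- \<mu> s * of_real (s * x))))"

lemma is_modeD:
  assumes "is_mode c u" "s = 1 \<or> s = -1"
  shows "AE x in lebesgue. s * x > 0 \<longrightarrow>
      component u 1 x = c * of_real k / V s * exp (- \<mu> s * of_real (s * x))"
    and "AE x in lebesgue. s * x > 0 \<longrightarrow> component u 2 x = c * \<kappa> s * exp (- \<mu> s * of_real (s * x))"
    and "AE x in lebesgue. s * x > 0 \<longrightarrow> component u 3 x = c * exp (- \<mu> s * of_real (s * x))"
  using assms unfolding is_mode_def by (auto elim: eventually_mono)

lemma is_mode_zero: "is_mode 0 0"
  unfolding is_mode_def
proof (intro allI impI)
  fix s :: real
  show "AE x in lebesgue. s * x > 0 \<longrightarrow>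
     component 0 1 x = 0 * of_real k / V s * exp (- \<mu> s * of_real (s * x)) \<and>
     component 0 2 x = 0 * \<kappa> s * exp (- \<mu> s * of_real (s * x)) \<and>
     component 0 3 x = 0 * exp (- \<mu> s * of_real (s * x))"
    using component_zero[of 1] component_zero[of 2] component_zero[of 3]
    by eventually_elim simp
qed

lemma is_mode_unique:
  assumes "is_mode c u" "is_mode c v"
  shows "u = v"
proof (rule L2_eqI)
  fix i :: 3
  show "AE x in lebesgue. component u i x = component v i x"
  proof (rule AE_half_lines)
    fix s :: real assume s: "s = 1 \<or> s = -1"
    show "AE x in lebesgue. s * x > 0 \<longrightarrow> component u i x = component v i x"
      using is_modeD[OF assms(1) s] is_modeD[OF assms(2) s]
      by eventually_elim (use exhaust_3[of i] in auto)
  qed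
qed

lemma is_mode_scale:
  assumes "is_mode c u"
  shows "is_mode (d * c) (scale_L2 d u)"
  unfolding is_mode_def
proof (intro allI impI)
  fix s :: real assume s: "s = 1 \<or> s = -1"
  show "AE x in lebesgue. s * x > 0 \<longrightarrow>
     component (scale_L2 d u) 1 x = d * c * of_real k / V s * exp (- \<mu> s * of_real (s * x)) \<and>
     component (scale_L2 d u) 2 x = d * c * \<kappa> s * exp (- \<mu> s * of_real (s * x)) \<and>
     component (scale_L2 d u) 3 x = d * c * exp (- \<mu> s * of_real (s * x))"
    using is_modeD[OF assms s] component_scale[of d u 1] component_scale[of d u 2] component_scale[of d u 3]
    by eventually_elim simp
qed

lemma is_mode_nonzero:
  assumes "is_mode c u" "c \<noteq> 0"
  shows "u \<noteq> 0"
proof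
  assume "u = 0"
  have "AE x::real in lebesgue. False"
  proof (rule AE_half_lines)
    fix s :: real assume s: "s = 1 \<or> s = -1"
    show "AE x in lebesgue. s * x > 0 \<longrightarrow> False"
      using is_modeD(3)[OF assms(1) s] component_zero[of 3]
      by eventually_elim (use assms(2) \<open>u = 0\<close> in auto)
  qed
  with AE_lebesgue_False show False by simp
qed

lemma half_line_of_mode:
  assumes "u \<in> dom_A" "pencil (two_layer Vp Vm) k \<omega> u = v" "is_mode c v"
  obtains P Q where "\<And>s. s = 1 \<or> s = -1 \<Longrightarrow> half_line s (V s) (\<mu> s) (of_real k) c P Q"
    "AE x in lebesgue. component u 3 x = P x" "AE x in lebesgue. component u 2 x = Q x"
  by (rule half_line_of_solution[OF assms(1,2) is_modeD[OF assms(3)]]; (assumption | (rule that; assumption)))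

lemma kernel_is_mode:
  assumes u: "u \<in> dom_A" and 0: "pencil (two_layer Vp Vm) k \<omega> u = 0"
  obtains c where "is_mode c u"
    "c \<noteq> 0 \<Longrightarrow> Re (\<mu> 1) > 0 \<and> Re (\<mu> (-1)) > 0 \<and> \<kappa> 1 = \<kappa> (-1)"
proof -
  obtain P Q where hl: "\<And>s. s = 1 \<or> s = -1 \<Longrightarrow> half_line s (V s) (\<mu> s) (of_real k) 0 P Q"
    and PQ: "AE x in lebesgue. component u 3 x = P x" "AE x in lebesgue. component u 2 x = Q x"
    using half_line_of_mode[OF u 0 is_mode_zero] by blast
  have P: "P (s * t) = P 0 * exp (- \<mu> s * of_real t)"
    and Q: "Q (s * t) = \<kappa> s * P (s * t)" if "s = 1 \<or> s = -1" "t \<ge> 0" for s t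
    using half_line.homogeneous(1,2)[OF hl[OF that(1)] refl that(2)] by (simp_all add: \<kappa>_def)
  show thesis
  proof (rule that[of "P 0"])
    show "is_mode (P 0) u"
      unfolding is_mode_def
    proof (intro allI impI)
      fix s :: real assume s: "s = 1 \<or> s = -1"
      then have ss: "s * (s * x) = x" for x by auto
      show "AE x in lebesgue. s * x > 0 \<longrightarrow>
         component u 1 x = P 0 * of_real k / V s * exp (- \<mu> s * of_real (s * x)) \<and>
         component u 2 x = P 0 * \<kappa> s * exp (- \<mu> s * of_real (s * x)) \<and>
         component u 3 x = P 0 * exp (- \<mu> s * of_real (s * x))"
        using PQ 0[unfolded pencil_eq_iff[OF u]] component_zero[of 1]
      proof eventually_elim
        case (elim x)
        show ?case
        proof
          assume x: "s * x > 0"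
          have "\<i> * of_real k * component u 3 x - \<i> * V s * component u 1 x = 0"
            using elim V_eq[OF s x] by simp
          then have "component u 1 x = of_real k / V s * component u 3 x"
            using V_nonzero[of s] by (simp add: field_simps)
          then show "component u 1 x = P 0 * of_real k / V s * exp (- \<mu> s * of_real (s * x)) \<and>
              component u 2 x = P 0 * \<kappa> s * exp (- \<mu> s * of_real (s * x)) \<and>
              component u 3 x = P 0 * exp (- \<mu> s * of_real (s * x))"
            using elim P[OF s, of "s * x"] Q[OF s, of "s * x"] x unfolding ss by simp
        qed
      qed
    qed
    assume "P 0 \<noteq> 0"
    then have "Re (\<mu> s) > 0" if "s = 1 \<or> s = -1" for s
      using half_line.homogeneous(3)[OF hl[OF that] refl] Re_\<mu>[of s] by fastforce
    moreover have "Q 0 = \<kappa> s * P 0" if "s = 1 \<or> s = -1" for s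
      using Q[OF that, of 0] by simp
    then have "\<kappa> 1 * P 0 = \<kappa> (-1) * P 0" by metis
    ultimately show "Re (\<mu> 1) > 0 \<and> Re (\<mu> (-1)) > 0 \<and> \<kappa> 1 = \<kappa> (-1)"
      using \<open>P 0 \<noteq> 0\<close> by simp
  qed
qed

text \<open>Realizes an ansatz in \<open>dom_A\<close> without imposing the equation. Component 1
  has no matching condition because its derivative does not occur in \<open>A\<close>.\<close>

lemma layer_solution:
  fixes a b :: "3 \<Rightarrow> real \<Rightarrow> complex"
  assumes re: "Re (\<mu> 1) > 0" "Re (\<mu> (-1)) > 0"
    and match: "a 2 1 = a 2 (-1)" "a 3 1 = a 3 (-1)"
  obtains u where "u \<in> dom_A"
    "\<And>i s. s = 1 \<or> s = -1 \<Longrightarrow> AE x in lebesgue. s * x > 0 \<longrightarrow>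
       component u i x = decay (\<mu> s) (a i s) (b i s) (s * x)"
    "\<And>i s. s = 1 \<or> s = -1 \<Longrightarrow> i = 2 \<or> i = 3 \<Longrightarrow> AE x in lebesgue. s * x > 0 \<longrightarrow>
       weak_deriv (component u i) x
         = of_real s * decay (\<mu> s) (b i s - \<mu> s * a i s) (- \<mu> s * b i s) (s * x)"
proof -
  define f where "f i = layer (decay (\<mu> 1) (a i 1) (b i 1)) (decay (\<mu> (-1)) (a i (-1)) (b i (-1)))" for i
  define g where "g i = layer (decay (\<mu> 1) (b i 1 - \<mu> 1 * a i 1) (- \<mu> 1 * b i 1))
    (decay (\<mu> (-1)) (\<mu> (-1) * a i (-1) - b i (-1)) (\<mu> (-1) * b i (-1)))" for i
  define u where "u = abs_L2 (\<lambda>x. vector [f 1 x, f 2 x, f 3 x])"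
  have f: "square_integrable (f i)" and g: "square_integrable (g i)" for i
    unfolding f_def g_def by (intro square_integrable_layer_decay re)+
  have "is_weak_deriv (f 2) (g 2)" "is_weak_deriv (f 3) (g 3)"
    unfolding f_def g_def match by (rule is_weak_deriv_layer_decay[OF re])+
  note u = component_abs_L2[OF f g g this, folded u_def]
  have gi: "AE x in lebesgue. weak_deriv (component u i) x = g i x" if "i = 2 \<or> i = 3" for i
    using that u(3,4) by blast
  show thesis
  proof (rule that[OF u(1)])
    fix i :: 3 and s :: real assume s: "s = 1 \<or> s = -1"
    have fs: "f i x = decay (\<mu> s) (a i s) (b i s) (s * x)" if "s * x > 0" for x
      using s that by (auto simp: f_def layer_def)
    show "AE x in lebesgue. s * x > 0 \<longrightarrow> component u i x = decay (\<mu> s) (a i s) (b i s) (s * x)"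
      using u(2)[of i] by eventually_elim (simp add: fs)
    assume i: "i = 2 \<or> i = 3"
    have gs: "g i x = of_real s * decay (\<mu> s) (b i s - \<mu> s * a i s) (- \<mu> s * b i s) (s * x)" if "s * x > 0" for x
      using s that by (auto simp: g_def layer_def decay_def algebra_simps)
    show "AE x in lebesgue. s * x > 0 \<longrightarrow> weak_deriv (component u i) x
         = of_real s * decay (\<mu> s) (b i s - \<mu> s * a i s) (- \<mu> s * b i s) (s * x)"
      using gi[OF i] by eventually_elim (simp add: gs)
  qed
qed

lemma mode_exists:
  assumes re: "Re (\<mu> 1) > 0" "Re (\<mu> (-1)) > 0" and \<kappa>: "\<kappa> 1 = \<kappa> (-1)"
  obtains u where "u \<in> dom_A" "is_mode c u" "pencil (two_layer Vp Vm) k \<omega> u = 0"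
proof -
  define a where "a = (\<lambda>i :: 3. \<lambda>s. if i = 1 then c * of_real k / V s else if i = 2 then c * \<kappa> s else c)"
  have a: "a 1 = (\<lambda>s. c * of_real k / V s)" "a 2 = (\<lambda>s. c * \<kappa> s)" "a 3 = (\<lambda>s. c)"
    by (auto simp: a_def)
  obtain u where u: "u \<in> dom_A"
    "\<And>i s. s = 1 \<or> s = -1 \<Longrightarrow> AE x in lebesgue. s * x > 0 \<longrightarrow>
       component u i x = decay (\<mu> s) (a i s) 0 (s * x)"
    "\<And>i s. s = 1 \<or> s = -1 \<Longrightarrow> i = 2 \<or> i = 3 \<Longrightarrow> AE x in lebesgue. s * x > 0 \<longrightarrow>
       weak_deriv (component u i) x = of_real s * decay (\<mu> s) (0 - \<mu> s * a i s) (- \<mu> s * 0) (s * x)"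
    by (rule layer_solution[OF re, of a "\<lambda>_ _. 0"]) (use \<kappa> in \<open>simp_all only: a\<close>)
  have "is_mode c u"
    unfolding is_mode_def
  proof (intro allI impI)
    fix s :: real assume s: "s = 1 \<or> s = -1"
    show "AE x in lebesgue. s * x > 0 \<longrightarrow>
       component u 1 x = c * of_real k / V s * exp (- \<mu> s * of_real (s * x)) \<and>
       component u 2 x = c * \<kappa> s * exp (- \<mu> s * of_real (s * x)) \<and>
       component u 3 x = c * exp (- \<mu> s * of_real (s * x))"
      using u(2)[OF s, of 1] u(2)[OF s, of 2] u(2)[OF s, of 3]
      by eventually_elim (simp add: decay_def a)
  qed
  moreover have "pencil (two_layer Vp Vm) k \<omega> u = 0"
    unfolding pencil_eq_iff[OF u(1)]
  proof (rule AE_half_lines)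
    fix s :: real assume s: "s = 1 \<or> s = -1"
    define r where "r = inverse (V s)"
    have r: "V s * r = 1" using V_nonzero by (simp add: r_def)
    have ss: "complex_of_real s * of_real s = 1" using s by auto
    have ii: "\<i> * \<i> = -1" by simp
    have \<mu>2: "\<mu> s * \<mu> s = of_real k * of_real k + \<omega> * V s"
      using \<mu>_squared[of s] by (simp add: power2_eq_square)
    have \<kappa>s: "\<kappa> s = - \<i> * of_real s * \<mu> s * r" by (simp add: \<kappa>_def r_def divide_inverse)
    show "AE x in lebesgue. s * x > 0 \<longrightarrow>
      \<i> * of_real k * component u 3 x - \<i> * V x * component u 1 x = component 0 1 x \<and>
      - weak_deriv (component u 3) x - \<i> * V x * component u 2 x = component 0 2 x \<and>
      - \<i> * of_real k * component u 1 x + weak_deriv (component u 2) x - \<i> * \<omega> * component u 3 x = component 0 3 x"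
      using u(2)[OF s, of 1] u(2)[OF s, of 2] u(2)[OF s, of 3] u(3)[OF s disjI1[OF refl]] u(3)[OF s disjI2[OF refl]]
        component_zero[of 1] component_zero[of 2] component_zero[of 3]
    proof eventually_elim
      case (elim x)
      show ?case
      proof
        assume x: "s * x > 0"
        define e where "e = exp (- \<mu> s * of_real (s * x))"
        have e: "component u 1 x = c * of_real k * r * e" "component u 2 x = c * \<kappa> s * e"
          "component u 3 x = c * e"
          "weak_deriv (component u 2) x = of_real s * (- \<mu> s * (c * \<kappa> s)) * e"
          "weak_deriv (component u 3) x = of_real s * (- \<mu> s * c) * e"
          "component 0 1 x = 0" "component 0 2 x = 0" "component 0 3 x = 0"
          using elim x by (auto simp: decay_def a e_def r_def divide_inverse)
        show "\<i> * of_real k * component u 3 x - \<i> * V x * component u 1 x = component 0 1 x \<and>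
          - weak_deriv (component u 3) x - \<i> * V x * component u 2 x = component 0 2 x \<and>
          - \<i> * of_real k * component u 1 x + weak_deriv (component u 2) x - \<i> * \<omega> * component u 3 x = component 0 3 x"
          unfolding V_eq[OF s x] e \<kappa>s
          apply (intro conjI)
          subgoal using r by algebra
          subgoal using r ss ii by algebra
          subgoal using r ss ii \<mu>2 by algebra
          done
      qed
    qed
  qed
  ultimately show thesis using that u(1) by blast
qed

lemma generalized_mode_exists:
  assumes re: "Re (\<mu> 1) > 0" "Re (\<mu> (-1)) > 0" and \<kappa>: "\<kappa> 1 = \<kappa> (-1)"
    and sum: "slope_sum = 0" and v: "is_mode 1 v"
  obtains u where "u \<in> dom_A" "pencil (two_layer Vp Vm) k \<omega> u = v"
proof -
  \<comment> \<open>The third component is sought as \<beta> t e, vanishing at 0, which can be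
    arranged by subtracting a multiple of the mode. The first two equations then give
    \<open>a\<close> and \<open>b\<close> for the other components, and the third one fixes
    \<beta>.\<close>
  define \<beta> where "\<beta> s = \<i> * ((V s)\<^sup>2 + (\<mu> s)\<^sup>2 - (of_real k)\<^sup>2) / (2 * \<mu> s * V s)" for s
  define a where "a = (\<lambda>i :: 3. \<lambda>s. if i = 1 then \<i> * of_real k / (V s)\<^sup>2
    else if i = 2 then \<i> / V s * (of_real s * \<beta> s + \<kappa> s) else 0)"
  define b where "b = (\<lambda>i :: 3. \<lambda>s. if i = 1 then of_real k * \<beta> s / V s
    else if i = 2 then - \<i> / V s * of_real s * \<mu> s * \<beta> s else \<beta> s)"
  have ab: "a 1 = (\<lambda>s. \<i> * of_real k / (V s)\<^sup>2)" "a 2 = (\<lambda>s. \<i> / V s * (of_real s * \<beta> s + \<kappa> s))"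
    "a 3 = (\<lambda>s. 0)" "b 1 = (\<lambda>s. of_real k * \<beta> s / V s)"
    "b 2 = (\<lambda>s. - \<i> / V s * of_real s * \<mu> s * \<beta> s)" "b 3 = \<beta>"
    by (auto simp: a_def b_def)
  have \<mu>0: "\<mu> s \<noteq> 0" if "s = 1 \<or> s = -1" for s using re that by auto
  \<comment> \<open>This is the value of Q at 0 that \<open>inhomogeneous\<close> forces for P 0 = 0
    and c = 1, so matching the two sides means \<open>slope_sum = 0\<close>.\<close>
  have a2: "a 2 s = - of_real s * wronskian_slope (of_real k) (V s) (\<mu> s) / (2 * \<mu> s)" if s: "s = 1 \<or> s = -1" for s
  proof -
    define r m where "r = inverse (V s)" and "m = inverse (2 * \<mu> s)"
    have "V s * r = 1" "2 * \<mu> s * m = 1"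
      using V_nonzero \<mu>0[OF s] by (simp_all add: r_def m_def)
    moreover have "\<i> * \<i> = -1" by simp
    ultimately have "\<i> * r * (of_real s * (\<i> * (V s * V s + \<mu> s * \<mu> s - of_real k * of_real k) * (m * r))
        + - \<i> * of_real s * \<mu> s * r)
      = - of_real s * (1 - (of_real k * of_real k + \<mu> s * \<mu> s) * (r * r)) * m"
      by algebra
    then show ?thesis
      unfolding ab wronskian_slope_def \<beta>_def \<kappa>_def
      unfolding r_def m_def divide_inverse power2_eq_square inverse_mult_distrib .
  qed
  have a2_match: "a 2 1 = a 2 (-1)"
    using sum unfolding a2[of 1, simplified] a2[of "-1", simplified] slope_sum_def
    by (simp add: add_eq_0_iff)
  obtain u where u: "u \<in> dom_A"
    "\<And>i s. s = 1 \<or> s = -1 \<Longrightarrow> AE x in lebesgue. s * x > 0 \<longrightarrow>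
       component u i x = decay (\<mu> s) (a i s) (b i s) (s * x)"
    "\<And>i s. s = 1 \<or> s = -1 \<Longrightarrow> i = 2 \<or> i = 3 \<Longrightarrow> AE x in lebesgue. s * x > 0 \<longrightarrow>
       weak_deriv (component u i) x = of_real s * decay (\<mu> s) (b i s - \<mu> s * a i s) (- \<mu> s * b i s) (s * x)"
    by (rule layer_solution[OF re, of a b]) (simp_all only: ab(3) a2_match)
  have "pencil (two_layer Vp Vm) k \<omega> u = v"
    unfolding pencil_eq_iff[OF u(1)]
  proof (rule AE_half_lines)
    fix s :: real assume s: "s = 1 \<or> s = -1"
    define r where "r = inverse (V s)"
    have r: "V s * r = 1" using V_nonzero by (simp add: r_def)
    have ss: "complex_of_real s * of_real s = 1" using s by auto
    have ii: "\<i> * \<i> = -1" by simp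
    have \<mu>2: "\<mu> s * \<mu> s = of_real k * of_real k + \<omega> * V s"
      using \<mu>_squared[of s] by (simp add: power2_eq_square)
    have \<kappa>s: "\<kappa> s = - \<i> * of_real s * \<mu> s * r" by (simp add: \<kappa>_def r_def divide_inverse)
    have cancel: "2 * \<mu> s * (X / (2 * \<mu> s * V s)) = X * r" for X
    proof -
      have "2 * \<mu> s * (X / (2 * \<mu> s * V s)) = X / V s"
        using \<mu>0[OF s] by simp
      then show ?thesis by (simp only: r_def divide_inverse)
    qed
    have \<beta>s: "2 * \<mu> s * \<beta> s = \<i> * (V s * V s + \<mu> s * \<mu> s - of_real k * of_real k) * r"
      unfolding \<beta>_def cancel power2_eq_square ..
    show "AE x in lebesgue. s * x > 0 \<longrightarrow>
      \<i> * of_real k * component u 3 x - \<i> * V x * component u 1 x = component v 1 x \<and>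
      - weak_deriv (component u 3) x - \<i> * V x * component u 2 x = component v 2 x \<and>
      - \<i> * of_real k * component u 1 x + weak_deriv (component u 2) x - \<i> * \<omega> * component u 3 x = component v 3 x"
      using u(2)[OF s, of 1] u(2)[OF s, of 2] u(2)[OF s, of 3] u(3)[OF s disjI1[OF refl]] u(3)[OF s disjI2[OF refl]]
        is_modeD[OF v s]
    proof eventually_elim
      case (elim x)
      show ?case
      proof
        assume x: "s * x > 0"
        define e where "e = exp (- \<mu> s * of_real (s * x))"
        define t where "t = complex_of_real (s * x)"
        define q where "q = - \<i> * r * of_real s * \<mu> s * \<beta> s"
        define q0 where "q0 = \<i> * r * (of_real s * \<beta> s + \<kappa> s)"
        have e: "component u 1 x = (\<i> * of_real k * (r * r) + of_real k * \<beta> s * r * t) * e"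
          "component u 2 x = (q0 + q * t) * e"
          "component u 3 x = \<beta> s * t * e"
          "weak_deriv (component u 2) x = of_real s * ((q - \<mu> s * q0) + - \<mu> s * q * t) * e"
          "weak_deriv (component u 3) x = of_real s * (\<beta> s + - \<mu> s * \<beta> s * t) * e"
          "component v 1 x = of_real k * r * e" "component v 2 x = \<kappa> s * e" "component v 3 x = e"
          using elim x by (simp_all only: decay_def ab e_def t_def q_def q0_def r_def divide_inverse
            power2_eq_square inverse_mult_distrib mult_1_left add_0_left diff_0_right mult_zero_right
            mult.assoc simp_thms)
        show "\<i> * of_real k * component u 3 x - \<i> * V x * component u 1 x = component v 1 x \<and>
          - weak_deriv (component u 3) x - \<i> * V x * component u 2 x = component v 2 x \<and>
          - \<i> * of_real k * component u 1 x + weak_deriv (component u 2) x - \<i> * \<omega> * component u 3 x = component v 3 x"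
          unfolding V_eq[OF s x] e q_def q0_def
          apply (intro conjI)
          subgoal using r ii by algebra
          subgoal using r ss ii by algebra
          subgoal unfolding \<kappa>s by (rule generalized_mode_identity[OF r ii ss \<mu>2 \<beta>s])
          done
      qed
    qed
  qed
  with u(1) show thesis by (rule that)
qed

section \<open>Eigenvalues and their multiplicities\<close>

lemma eigenvalue_iff:
  "(\<exists>u \<in> dom_A - {0}. pencil (two_layer Vp Vm) k \<omega> u = 0) \<longleftrightarrow>
    Re (\<mu> 1) > 0 \<and> Re (\<mu> (-1)) > 0 \<and> \<kappa> 1 = \<kappa> (-1)"
proof
  assume "\<exists>u \<in> dom_A - {0}. pencil (two_layer Vp Vm) k \<omega> u = 0"
  then obtain u where u: "u \<in> dom_A" "u \<noteq> 0" "pencil (two_layer Vp Vm) k \<omega> u = 0" by blast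
  then obtain c where c: "is_mode c u"
    "c \<noteq> 0 \<Longrightarrow> Re (\<mu> 1) > 0 \<and> Re (\<mu> (-1)) > 0 \<and> \<kappa> 1 = \<kappa> (-1)"
    using kernel_is_mode by blast
  moreover have "c \<noteq> 0" using c(1) u(2) is_mode_unique is_mode_zero by blast
  ultimately show "Re (\<mu> 1) > 0 \<and> Re (\<mu> (-1)) > 0 \<and> \<kappa> 1 = \<kappa> (-1)" by blast
next
  assume "Re (\<mu> 1) > 0 \<and> Re (\<mu> (-1)) > 0 \<and> \<kappa> 1 = \<kappa> (-1)"
  then obtain u where "u \<in> dom_A" "is_mode 1 u" "pencil (two_layer Vp Vm) k \<omega> u = 0"
    using mode_exists by blast
  then show "\<exists>u \<in> dom_A - {0}. pencil (two_layer Vp Vm) k \<omega> u = 0"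
    using is_mode_nonzero[of 1 u] by auto
qed

lemma eigenvalue_simplicity:
  assumes eig: "\<exists>u \<in> dom_A - {0}. pencil (two_layer Vp Vm) k \<omega> u = 0"
  shows "geometrically_simple (two_layer Vp Vm) k \<omega>"
    and "algebraically_simple (two_layer Vp Vm) k \<omega> \<longleftrightarrow> slope_sum \<noteq> 0"
proof -
  have re: "Re (\<mu> 1) > 0" "Re (\<mu> (-1)) > 0" and \<kappa>: "\<kappa> 1 = \<kappa> (-1)"
    using eig by (auto simp: eigenvalue_iff)
  obtain w where w: "w \<in> dom_A" "is_mode 1 w" "pencil (two_layer Vp Vm) k \<omega> w = 0"
    using mode_exists[OF re \<kappa>] by blast
  have w0: "w \<noteq> 0" by (rule is_mode_nonzero[OF w(2)]) simp
  have ind: "L2.independent {w}" using w0 by (simp add: L2.independent_insert L2.independent_empty)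
  let ?ker = "ker_pencil (two_layer Vp Vm) k \<omega>"
  have kerD: "\<exists>c. is_mode c u \<and> u = scale_L2 c w" if "u \<in> ?ker" for u
  proof -
    from that obtain c where "is_mode c u"
      using kernel_is_mode[of u] by (auto simp: ker_pencil_def)
    moreover have "is_mode c (scale_L2 c w)" using is_mode_scale[OF w(2), of c] by simp
    ultimately show ?thesis using is_mode_unique by blast
  qed
  have w_ker: "w \<in> ?ker" using w by (simp add: ker_pencil_def)
  have "?ker \<subseteq> L2.span {w}"
    using kerD by (auto simp: L2.span_singleton)
  then have "L2.span ?ker \<subseteq> L2.span {w}" by (metis L2.span_mono L2.span_span)
  moreover have "L2.span {w} \<subseteq> L2.span ?ker" using w_ker by (intro L2.span_mono) simp
  ultimately have "L2.dim ?ker = card {w}"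
    using ind by (intro L2.dim_eq_card) auto
  then show gs: "geometrically_simple (two_layer Vp Vm) k \<omega>"
    by (simp add: geometrically_simple_def)
  have "slope_sum = 0" if uv: "u \<in> dom_A" "v \<in> ?ker - {0}" "pencil (two_layer Vp Vm) k \<omega> u = v" for u v
  proof -
    obtain c where c: "is_mode c v" using uv(2) kerD by blast
    then have c0: "c \<noteq> 0" using uv(2) is_mode_unique is_mode_zero by blast
    obtain P Q where hl: "\<And>s. s = 1 \<or> s = -1 \<Longrightarrow> half_line s (V s) (\<mu> s) (of_real k) c P Q"
      using half_line_of_mode[OF uv(1,3) c] by blast
    have Q: "Q 0 - \<kappa> s * P 0 = - (of_real s * c * wronskian_slope (of_real k) (V s) (\<mu> s) / (2 * \<mu> s))"
      if s: "s = 1 \<or> s = -1" for s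
      using half_line.inhomogeneous[OF hl[OF s]] s re unfolding \<kappa>_def by blast
    \<comment> \<open>Subtracting the two relations cancels \<open>Q 0\<close>, and also the terms
      in \<open>P 0\<close> because \<kappa> is the same on both sides.\<close>
    have "c * slope_sum = 0"
      using Q[of 1] Q[of "-1"] \<kappa> by (simp add: slope_sum_def algebra_simps)
    with c0 show ?thesis by simp
  qed
  moreover have "\<exists>u \<in> dom_A. \<exists>v \<in> ?ker - {0}. pencil (two_layer Vp Vm) k \<omega> u = v \<and> u \<noteq> v \<and> L2.independent {u, v}"
    if sum: "slope_sum = 0"
  proof -
    obtain u where u: "u \<in> dom_A" "pencil (two_layer Vp Vm) k \<omega> u = w"
      using generalized_mode_exists[OF re \<kappa> sum w(2)] .
    \<comment> \<open>A multiple of \<open>w\<close> is the mode of some amplitude, hence lies in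
      the kernel by uniqueness of modes. This replaces an appeal to linearity of the pencil, whose
      weak derivatives are choices.\<close>
    have "u \<notin> L2.span {w}"
    proof
      assume "u \<in> L2.span {w}"
      then obtain c where "u = scale_L2 c w" by (auto simp: L2.span_singleton)
      then have "is_mode c u" using is_mode_scale[OF w(2), of c] by simp
      moreover obtain u' where u': "is_mode c u'" "pencil (two_layer Vp Vm) k \<omega> u' = 0"
        using mode_exists[OF re \<kappa>] by blast
      ultimately have "u' = u" using is_mode_unique by blast
      with u' u(2) w0 show False by simp
    qed
    moreover from this have "u \<noteq> w" using L2.span_base[of w "{w}"] by auto
    ultimately show ?thesis
      using u w_ker w0 ind by (intro bexI[of _ u] bexI[of _ w]) (auto simp: L2.independent_insert)
  qed
  ultimately show "algebraically_simple (two_layer Vp Vm) k \<omega> \<longleftrightarrow> slope_sum \<noteq> 0"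
    unfolding algebraically_simple_def using gs by blast
qed

end

section \<open>The dispersion relation\<close>

text \<open>The dispersion relation leaves the parameters r = m/a = - n/b, a and b, with w = r^2 (a
  + b) and k^2 = - r^2 a b. Both sides then reduce to E = 0, where a - b is nonzero because m + n =
  r (a - b). The term (k^2 + w a) b^2 only looks asymmetric: it is m^2 b^2 = n^2 a^2.\<close>

lemma slope_sum_algebra:
  fixes a b k w m n :: complex
  assumes "a \<noteq> 0" "b \<noteq> 0" "w \<noteq> 0" "m \<noteq> 0" "n \<noteq> 0" and mn: "m + n \<noteq> 0"
    and m: "m\<^sup>2 = k\<^sup>2 + w * a" and n: "n\<^sup>2 = k\<^sup>2 + w * b" and disp: "m * b + n * a = 0"
  shows "wronskian_slope k a m / (2 * m) + wronskian_slope k b n / (2 * n) = 0 \<longleftrightarrow>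
    (2 * k\<^sup>2 + w * a) * (2 * k\<^sup>2 + w * b) - 2 * k ^ 4 - (k\<^sup>2 + w * a) * b\<^sup>2 = 0"
proof -
  define r where "r = m / a"
  have r: "r \<noteq> 0" "m = r * a" using assms by (auto simp: r_def)
  have nr: "n = - r * b"
  proof -
    have "(n + r * b) * a = 0" using disp r(2) by algebra
    then show ?thesis using assms(1) by (simp add: eq_neg_iff_add_eq_0)
  qed
  have ab: "a \<noteq> b" using mn nr r(2) by auto
  have w: "w = r\<^sup>2 * (a + b)"
  proof -
    \<comment> \<open>The difference of the equations for m^2 and n^2, which eliminates k.\<close>
    have "(w - r\<^sup>2 * (a + b)) * (a - b) = 0"
      using m n unfolding r(2) nr by algebra
    then show ?thesis using ab by simp
  qed
  have k: "k\<^sup>2 = - r\<^sup>2 * (a * b)"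
    using m unfolding r(2) w by algebra
  define E where "E = a * b + r\<^sup>2 * (a\<^sup>2 + b\<^sup>2)"
  have slope: "wronskian_slope k v u / (2 * u) * (2 * u * v\<^sup>2) = v\<^sup>2 - (k\<^sup>2 + u\<^sup>2)"
    if "u \<noteq> 0" "v \<noteq> 0" for u v
  proof -
    have "wronskian_slope k v u / (2 * u) * (2 * u * v\<^sup>2) = wronskian_slope k v u * v\<^sup>2"
      using that by simp
    also have "\<dots> = v\<^sup>2 - (k\<^sup>2 + u\<^sup>2)"
      using that by (simp add: wronskian_slope_def left_diff_distrib)
    finally show ?thesis .
  qed
  define X Y where "X = wronskian_slope k a m / (2 * m)" and "Y = wronskian_slope k b n / (2 * n)"
  have X: "X * (2 * (r * a) * a\<^sup>2) = a\<^sup>2 - (k\<^sup>2 + (r * a)\<^sup>2)"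
    using slope[OF assms(4,1)] unfolding X_def[symmetric] unfolding r(2) .
  have Y: "Y * (2 * (- r * b) * b\<^sup>2) = b\<^sup>2 - (k\<^sup>2 + (- r * b)\<^sup>2)"
    using slope[OF assms(5,2)] unfolding Y_def[symmetric] unfolding nr .
  have "(X + Y) * (2 * r * a ^ 3 * b ^ 3)
      = X * (2 * (r * a) * a\<^sup>2) * b ^ 3 - Y * (2 * (- r * b) * b\<^sup>2) * a ^ 3"
    by (simp add: algebra_simps power2_eq_square power3_eq_cube)
  also have "\<dots> = a * b * (b - a) * E"
    unfolding X Y k E_def by (simp add: algebra_simps power2_eq_square power3_eq_cube)
  finally have 1: "X + Y = 0 \<longleftrightarrow> E = 0"
    using assms(1,2) r(1) ab by (metis mult_eq_0_iff power_not_zero right_minus_eq zero_neq_numeral)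
  have "(2 * k\<^sup>2 + w * a) * (2 * k\<^sup>2 + w * b) - 2 * k ^ 4 - (k\<^sup>2 + w * a) * b\<^sup>2 = - (r\<^sup>2 * (a * b) * E)"
    using k w unfolding E_def by algebra
  with 1 show ?thesis using assms(1,2) r(1) unfolding X_def Y_def by simp
qed

context two_layers
begin

lemma \<mu>_values:
  "\<mu> 1 = csqrt (of_real (k\<^sup>2) - W_of Vp \<omega>)" "\<mu> (-1) = csqrt (of_real (k\<^sup>2) - W_of Vm \<omega>)"
  by (simp_all add: \<mu>_def two_layer_def W_of_def)

text \<open>The sign \<open>s\<close> inside \<kappa> turns the equality of the two ratios into a
  sum equal to 0.\<close>

lemma \<kappa>_eq_iff: "\<kappa> 1 = \<kappa> (-1) \<longleftrightarrow> \<mu> 1 * Vm \<omega> + \<mu> (-1) * Vp \<omega> = 0"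
proof -
  have "\<kappa> 1 = \<kappa> (-1) \<longleftrightarrow> - \<mu> 1 / Vp \<omega> = \<mu> (-1) / Vm \<omega>"
  proof -
    have "\<kappa> 1 = \<i> * (- \<mu> 1 / Vp \<omega>)" "\<kappa> (-1) = \<i> * (\<mu> (-1) / Vm \<omega>)"
      by (simp_all add: \<kappa>_def two_layer_def)
    then show ?thesis by (simp only: mult_left_cancel[OF complex_i_not_zero])
  qed
  also have "\<dots> \<longleftrightarrow> \<mu> 1 * Vm \<omega> + \<mu> (-1) * Vp \<omega> = 0"
    by (simp only: frac_eq_eq[OF Vp Vm] mult_minus_left neg_eq_iff_add_eq_0)
  finally show ?thesis .
qed

end

lemma Re_csqrt_shift_pos_iff:
  "Re (csqrt (of_real (c::real) - z)) > 0 \<longleftrightarrow> z \<notin> complex_of_real ` {c..}"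
proof -
  have "of_real c - z \<in> complex_of_real ` {..0} \<longleftrightarrow> z \<in> complex_of_real ` {c..}"
  proof
    assume "of_real c - z \<in> complex_of_real ` {..0}"
    then obtain r where "r \<le> 0" "of_real c - z = of_real r" by auto
    then have "z = of_real (c - r)" "c - r \<in> {c..}" by (auto simp: algebra_simps)
    then show "z \<in> complex_of_real ` {c..}" by blast
  next
    assume "z \<in> complex_of_real ` {c..}"
    then obtain r where "r \<ge> c" "z = of_real r" by auto
    then have "of_real c - z = of_real (c - r)" "c - r \<in> {..0}" by auto
    then show "of_real c - z \<in> complex_of_real ` {..0}" by blast
  qed
  then show ?thesis by (simp only: Re_csqrt_pos_iff)
qed

theorem proposition2p4:
  fixes \<Omega> :: "complex set" and Vp Vm :: "complex \<Rightarrow> complex" and k :: real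
  shows "point_spectrum \<Omega> (two_layer Vp Vm) k - Omega0 \<Omega> Vp Vm = dispersion_set \<Omega> Vp Vm k \<and>
    (\<forall>\<omega> \<in> point_spectrum \<Omega> (two_layer Vp Vm) k - Omega0 \<Omega> Vp Vm.
        geometrically_simple (two_layer Vp Vm) k \<omega>) \<and>
    (\<forall>\<omega> \<in> point_spectrum \<Omega> (two_layer Vp Vm) k - Omega0 \<Omega> Vp Vm.
        algebraically_simple (two_layer Vp Vm) k \<omega> \<longleftrightarrow>
          (2 * of_real k ^ 2 - W_of Vp \<omega>) * (2 * of_real k ^ 2 - W_of Vm \<omega>)
            - 2 * of_real k ^ 4 - (of_real k ^ 2 - W_of Vp \<omega>) * Vm \<omega> ^ 2 \<noteq> 0)"
proof (intro conjI ballI)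
  have layers: "two_layers Vp Vm \<omega>" if "\<omega> \<in> \<Omega> - Omega0 \<Omega> Vp Vm" for \<omega>
    using that by unfold_locales (auto simp: Omega0_def)
  show "point_spectrum \<Omega> (two_layer Vp Vm) k - Omega0 \<Omega> Vp Vm = dispersion_set \<Omega> Vp Vm k"
  proof (rule set_eqI)
    fix \<omega>
    show "\<omega> \<in> point_spectrum \<Omega> (two_layer Vp Vm) k - Omega0 \<Omega> Vp Vm \<longleftrightarrow> \<omega> \<in> dispersion_set \<Omega> Vp Vm k"
    proof (cases "\<omega> \<in> \<Omega> - Omega0 \<Omega> Vp Vm")
      case True
      interpret two_layers Vp Vm k \<omega> by (rule layers[OF True])
      show ?thesis
        using True eigenvalue_iff unfolding \<kappa>_eq_iff \<mu>_values Re_csqrt_shift_pos_iff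
        by (auto simp: point_spectrum_def dispersion_set_def)
    qed (auto simp: point_spectrum_def dispersion_set_def)
  qed
  fix \<omega> assume "\<omega> \<in> point_spectrum \<Omega> (two_layer Vp Vm) k - Omega0 \<Omega> Vp Vm"
  then have \<omega>: "\<omega> \<in> \<Omega> - Omega0 \<Omega> Vp Vm"
    and eig: "\<exists>u \<in> dom_A - {0}. pencil (two_layer Vp Vm) k \<omega> u = 0"
    by (auto simp: point_spectrum_def)
  interpret two_layers Vp Vm k \<omega> by (rule layers[OF \<omega>])
  show "geometrically_simple (two_layer Vp Vm) k \<omega>"
    by (rule eigenvalue_simplicity(1)[OF eig])
  have re: "Re (\<mu> 1) > 0" "Re (\<mu> (-1)) > 0" and \<kappa>: "\<kappa> 1 = \<kappa> (-1)"
    using eig by (auto simp: eigenvalue_iff)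
  have "slope_sum = 0 \<longleftrightarrow>
    (2 * (of_real k)\<^sup>2 + \<omega> * Vp \<omega>) * (2 * (of_real k)\<^sup>2 + \<omega> * Vm \<omega>)
      - 2 * of_real k ^ 4 - ((of_real k)\<^sup>2 + \<omega> * Vp \<omega>) * (Vm \<omega>)\<^sup>2 = 0"
  proof -
    have V: "V 1 = Vp \<omega>" "V (-1) = Vm \<omega>" by (simp_all add: two_layer_def)
    \<comment> \<open>Positive real parts exclude \<mu>+ + \<mu>- = 0 and thereby, through the
      dispersion relation, equal values of V in the two layers.\<close>
    have "Re (\<mu> 1 + \<mu> (-1)) > 0" using re by simp
    then have "\<mu> 1 + \<mu> (-1) \<noteq> 0" by (metis less_irrefl zero_complex.sel(1))
    moreover have "\<omega> \<noteq> 0" "\<mu> 1 \<noteq> 0" "\<mu> (-1) \<noteq> 0" using \<omega> re by (auto simp: Omega0_def)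
    ultimately show ?thesis
      unfolding slope_sum_def V
      using slope_sum_algebra[OF Vp Vm _ _ _ _ _ _ \<kappa>[unfolded \<kappa>_eq_iff]]
        \<mu>_squared[of 1] \<mu>_squared[of "-1"] unfolding V by simp
  qed
  then show "algebraically_simple (two_layer Vp Vm) k \<omega> \<longleftrightarrow>
      (2 * of_real k ^ 2 - W_of Vp \<omega>) * (2 * of_real k ^ 2 - W_of Vm \<omega>)
        - 2 * of_real k ^ 4 - (of_real k ^ 2 - W_of Vp \<omega>) * Vm \<omega> ^ 2 \<noteq> 0"
    unfolding eigenvalue_simplicity(2)[OF eig] by (simp add: W_of_def)
qed

end
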